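(* Let $d \ge 2$ and let $\mu_1,\ldots,\mu_d$ be probability measures on $\mathbb{R}^d$, each absolutely continuous with respect to the Lebesgue measure. Then there exist two hyperplanes $H_1,H_2$ such that (i) $H_1\cup H_2$ splits $\mu_1$ into four equal parts, i.e. each of the four closed regions obtained by intersecting a closed half-space bounded by $H_1$ with a closed half-space bounded by $H_2$ has $\mu_1$-measure $1/4$; (ii) every closed half-space $H$ that contains $H_1\cap H_2$ satisfies $\mu_i(H)\ge \frac13$ for $i=2,3,\ldots,d-1$; and (iii) $H_1$ splits $\mu_d$ into two equal parts, i.e. each closed half-space bounded by $H_1$ has $\mu_d$-measure $1/2$. *)

theory Defs
  imports "HOL-Probability.Probability"
begin

definition is_hyperplane :: "'a::euclidean_space set \<Rightarrow> bool" where
  "is_hyperplane H \<longleftrightarrow> (\<exists>a b. a \<noteq> 0 \<and> H = {x. a \<bullet> x = b})"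

(* Replacing (a, b) by (-a, -b) keeps H and exchanges its two sides, so both closed
   half-spaces of H satisfy this predicate. *)
definition closed_halfspace_bounded_by :: "'a::euclidean_space set \<Rightarrow> 'a set \<Rightarrow> bool" where
  "closed_halfspace_bounded_by S H \<longleftrightarrow>
     (\<exists>a b. a \<noteq> 0 \<and> H = {x. a \<bullet> x = b} \<and> S = {x. a \<bullet> x \<le> b})"

definition is_closed_halfspace :: "'a::euclidean_space set \<Rightarrow> bool" where
  "is_closed_halfspace S \<longleftrightarrow> (\<exists>H. is_hyperplane H \<and> closed_halfspace_bounded_by S H)"

definition splits_into_two_equal_parts :: "'a::euclidean_space set \<Rightarrow> 'a measure \<Rightarrow> bool" where
  "splits_into_two_equal_parts H M \<longleftrightarrow>
     (\<forall>S. closed_halfspace_bounded_by S H \<longrightarrow> measure M S = 1 / 2)"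

definition split_into_four_equal_parts ::
    "'a::euclidean_space set \<Rightarrow> 'a set \<Rightarrow> 'a measure \<Rightarrow> bool" where
  "split_into_four_equal_parts H1 H2 M \<longleftrightarrow>
     (\<forall>S T. closed_halfspace_bounded_by S H1 \<longrightarrow> closed_halfspace_bounded_by T H2 \<longrightarrow>
        measure M (S \<inter> T) = 1 / 4)"

end

(*
A pair of hyperplanes is described by the unit normal u of H1, a unit vector v orthogonal to u, the
two offsets and the cosine of the angle between the normals. The conditions become continuous
equations on this configuration space, each even or odd under u -> -u and under v -> -v. For (ii),
integrate (1/3 - mass)^+ times the direction over all half-planes of span(u, v) whose boundary
passes through the projection of the intersection of H1 and H2. This vector vanishes only if the
projection is a centre point, because three half-spaces whose normals positively span the plane
cover the space.

The common zero comes from a discrete Borsuk-Ulam theorem. Spherical coordinates turn the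
configuration space into a box with glued facets. Triangulate the box finely, label the vertices by
the signs of the equations, and count modulo 2 the ordered simplices on whose j-th edge the j-th
sign changes. This count is a cup product of sign cocycles, so it depends only on the gluing, and
slicing one coordinate at a time shows that it is 1.
*)
theory Submission
  imports Defs "HOL-Library.Z2"
begin

section \<open>Counting sign jumps modulo 2\<close>

text \<open>With \<open>d = n + 1\<close> there are \<open>2 n + 3\<close> unknowns:
  \<open>n\<close> angles for each of \<open>u\<close> and \<open>v\<close>, two offsets and
  \<open>z\<close>. They face as many equations: two for each of the \<open>n - 1\<close> measures
  in (ii), one for (iii), three for (i), and \<open>u \<bullet> v = 0\<close>. Two independent sign
  changes act, so the theorem for a single antipodal map does not apply. The count is odd because of
  a triangular matching: each equation is assigned to a coordinate, it flips across that
  coordinate's own facet if this facet is glued, and a facet reflects only later coordinates.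
  Orthogonality is odd in both vectors; it is matched with an angle of \<open>v\<close>, and the
  angles of \<open>v\<close> precede those of \<open>u\<close>. Parallel hyperplanes, where no
  crossing point exists, are the degenerate positions. The equations for (ii) are multiplied by a
  factor vanishing there, and the quartering equation is given a strict sign there, so no common
  zero is degenerate.\<close>

lemma bit_add_self [simp]: "x + x = (0::bit)"
  by (cases x) auto

lemma bit_add_left_self [simp]: "x + (x + y) = (y::bit)"
  by (cases x; cases y) auto

lemma sum_bit_involution:
  fixes f :: "'a \<Rightarrow> bit"
  assumes "finite S"
    and "\<And>x. x \<in> S \<Longrightarrow> \<tau> x \<in> S" "\<And>x. x \<in> S \<Longrightarrow> \<tau> (\<tau> x) = x"
    and "\<And>x. x \<in> S \<Longrightarrow> f (\<tau> x) = f x" "\<And>x. x \<in> S \<Longrightarrow> \<tau> x = x \<Longrightarrow> f x = 0"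
  shows "sum f S = 0"
  using assms
proof (induction "card S" arbitrary: S rule: less_induct)
  case less
  show ?case
  proof (cases "S = {}")
    case False
    then obtain x where x: "x \<in> S" by blast
    let ?T = "S - {x, \<tau> x}"
    have "?T \<subset> S" using x by blast
    then have "card ?T < card S" by (simp add: less.prems(1) psubset_card_mono)
    then have 0: "sum f ?T = 0"
    proof (rule less.hyps)
      show "finite ?T" using less.prems(1) by blast
      show "\<tau> y \<in> ?T" if "y \<in> ?T" for y
        using that less.prems(2,3) x by (metis DiffD1 DiffD2 DiffI insert_iff singletonD)
    qed (use less.prems in auto)
    have "sum f S = sum f {x, \<tau> x} + sum f ?T"
      using sum.subset_diff[of "{x, \<tau> x}" S f] less.prems(1,2) x
      by (metis add.commute empty_subsetI insert_subset)
    moreover have "sum f {x, \<tau> x} = 0"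
      using less.prems(4,5) x by (cases "\<tau> x = x") auto
    ultimately show ?thesis using 0 by simp
  qed simp
qed

definition even_end :: "nat \<Rightarrow> nat" where
  "even_end c = (if even c then c else Suc c)"

definition odd_end :: "nat \<Rightarrow> nat" where
  "odd_end c = (if even c then Suc c else c)"

definition vertex :: "(nat \<Rightarrow> nat) \<Rightarrow> (nat \<Rightarrow> nat) \<Rightarrow> nat \<Rightarrow> nat \<Rightarrow> nat" where
  "vertex c \<rho> i = (\<lambda>k. if \<rho> k < i then odd_end (c k) else even_end (c k))"

text \<open>The pair \<open>(c, \<rho>)\<close> encodes the simplex in the unit cube with lower corner \<open>c\<close> whose \<open>i\<close>-th vertex
  has the coordinates of rank below \<open>i\<close> odd and the others even. Ordering vertices from even to
  odd makes this triangulation invariant under reflections of an even box, in contrast to the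
  usual coordinatewise order.\<close>

definition simplices :: "nat \<Rightarrow> nat \<Rightarrow> ((nat \<Rightarrow> nat) \<times> (nat \<Rightarrow> nat)) set" where
  "simplices m N = ({..<m} \<rightarrow>\<^sub>E {..<N}) \<times> {\<rho>. \<rho> permutes {..<m}}"

definition jumps :: "(nat \<Rightarrow> 'a \<Rightarrow> bit) \<Rightarrow> nat \<Rightarrow> (nat \<Rightarrow> 'a) \<Rightarrow> bit" where
  "jumps s m v = (\<Prod>j<m. s j (v j) + s j (v (Suc j)))"

definition jump_count :: "nat \<Rightarrow> nat \<Rightarrow> (nat \<Rightarrow> (nat \<Rightarrow> nat) \<Rightarrow> bit) \<Rightarrow> bit" where
  "jump_count m N s = (\<Sum>(c, \<rho>)\<in>simplices m N. jumps s m (vertex c \<rho>))"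

text \<open>The facet \<open>x k = 0\<close> is identified with \<open>x k = N\<close>, reflecting exactly those later coordinates
  \<open>l\<close> whose label changes sign under the identification. This choice is what makes the count of
  jumps odd.\<close>

definition glue :: "(nat \<Rightarrow> nat \<Rightarrow> bit) \<Rightarrow> 'a::minus \<Rightarrow> nat \<Rightarrow> nat \<Rightarrow> (nat \<Rightarrow> 'a) \<Rightarrow> nat \<Rightarrow> 'a" where
  "glue \<theta> N m k x = (\<lambda>l. if l = k then N - x l else if k < l \<and> l < m \<and> \<theta> l k = 1 then N - x l else x l)"

definition delete_at :: "nat \<Rightarrow> (nat \<Rightarrow> 'a) \<Rightarrow> nat \<Rightarrow> 'a" where
  "delete_at i v = (\<lambda>j. if j < i then v j else v (Suc j))"

section \<open>Jump products as closed cochains modulo 2\<close>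

lemma finite_simplices [simp]: "finite (simplices m N)"
  unfolding simplices_def by (intro finite_cartesian_product finite_PiE finite_permutations) auto

lemma jumps_Suc: "jumps s (Suc m) v = jumps s m v * (s m (v m) + s m (v (Suc m)))"
  by (simp add: jumps_def mult.commute)

lemma jumps_cong: "(\<And>i. i \<le> m \<Longrightarrow> v i = w i) \<Longrightarrow> jumps s m v = jumps s m w"
  unfolding jumps_def by (intro prod.cong) auto

text \<open>A product of coboundaries is closed: its sum over all facets of the simplex
  \<open>v 0\<close>, ..., \<open>v (Suc m)\<close> is zero. The facet without the last vertex, on
  which \<open>jumps\<close> has the same value as on \<open>v\<close>, stands on the right-hand
  side.\<close>

lemma sum_jumps_delete_at: "(\<Sum>i\<le>m. jumps s m (delete_at i v)) = jumps s m v"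
proof (induction m)
  case 0
  then show ?case by (simp add: jumps_def)
next
  case (Suc m)
  have "(\<Sum>i\<le>m. jumps s (Suc m) (delete_at i v))
      = (\<Sum>i\<le>m. jumps s m (delete_at i v)) * (s m (v (Suc m)) + s m (v (Suc (Suc m))))"
    unfolding sum_distrib_right by (intro sum.cong) (auto simp: jumps_Suc delete_at_def)
  moreover have "jumps s m (delete_at (Suc m) v) = jumps s m v"
    by (rule jumps_cong) (auto simp: delete_at_def)
  then have "jumps s (Suc m) (delete_at (Suc m) v) = jumps s m v * (s m (v m) + s m (v (Suc (Suc m))))"
    by (simp only: jumps_Suc) (simp add: delete_at_def)
  moreover have "r * (b + c) + r * (a + c) = r * (a + b)" for r a b c :: bit
    by (cases r; cases a; cases b; cases c) auto
  ultimately show ?case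
    by (simp only: Suc jumps_Suc sum.atMost_Suc)
qed


lemma even_end_le: "c < N \<Longrightarrow> even_end c \<le> N"
  by (auto simp: even_end_def)

lemma odd_end_le: "c < N \<Longrightarrow> odd_end c \<le> N"
  by (auto simp: odd_end_def)

lemma vertex_le: "(c, \<rho>) \<in> simplices m N \<Longrightarrow> k < m \<Longrightarrow> vertex c \<rho> i k \<le> N"
  by (auto simp: vertex_def simplices_def PiE_def Pi_def even_end_le odd_end_le)

text \<open>Directions in \<open>G\<close> are of Borsuk-Ulam type: across facet \<open>k\<close>,
  label \<open>j\<close> changes by \<open>\<theta> j k\<close>, and \<open>diag\<close> makes label
  \<open>k\<close> itself flip. The other directions are of Poincare-Miranda type. \<open>M\<close>
  is even so that the middle level \<open>M\<close> is the even end of both cells next to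
  it.\<close>

locale glued_labels =
  fixes m M :: nat and G :: "nat set" and \<theta> :: "nat \<Rightarrow> nat \<Rightarrow> bit"
    and s :: "nat \<Rightarrow> (nat \<Rightarrow> nat) \<Rightarrow> bit"
  assumes M: "even M" "0 < M"
    and diag: "\<And>k. k < m \<Longrightarrow> k \<in> G \<Longrightarrow> \<theta> k k = 1"
    and glue: "\<And>j k x. \<lbrakk>j < m; k < m; k \<in> G; \<And>l. l < m \<Longrightarrow> x l \<le> 2 * M; x k = 0\<rbrakk>
      \<Longrightarrow> s j (glue \<theta> (2 * M) m k x) = s j x + \<theta> j k"
    and low: "\<And>k x. \<lbrakk>k < m; k \<notin> G; \<And>l. l < m \<Longrightarrow> x l \<le> 2 * M; x k = 0\<rbrakk> \<Longrightarrow> s k x = 0"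
    and high: "\<And>k x. \<lbrakk>k < m; k \<notin> G; \<And>l. l < m \<Longrightarrow> x l \<le> 2 * M; x k = 2 * M\<rbrakk> \<Longrightarrow> s k x = 1"

text \<open>Each facet of a simplex opposite to its \<open>i\<close>-th vertex lies in exactly one other simplex,
  up to the gluing, so such facets cancel in pairs modulo 2.\<close>

lemma sum_inner_facets:
  assumes "\<And>v w. (\<And>j. j < m \<Longrightarrow> v j = w j) \<Longrightarrow> \<psi> v = (\<psi> w :: bit)" and "0 < i" "i < m"
  shows "(\<Sum>(c, \<rho>)\<in>simplices m N. \<psi> (delete_at i (vertex c \<rho>))) = 0"
proof (rule sum_bit_involution)
  \<comment> \<open>Exchanging the ranks \<open>i - 1\<close> and \<open>i\<close> changes the order
    in which two coordinates move, hence only vertex \<open>i\<close>.\<close>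
  let ?\<sigma> = "Transposition.transpose (i - 1) i"
  let ?\<tau> = "\<lambda>(c :: nat \<Rightarrow> nat, \<rho>). (c, ?\<sigma> \<circ> \<rho>)"
  have \<sigma>: "?\<sigma> permutes {..<m}" using assms by (intro permutes_swap_id) auto
  fix y assume y: "y \<in> simplices m N"
  then obtain c \<rho> where [simp]: "y = (c, \<rho>)" and \<rho>: "\<rho> permutes {..<m}"
    by (auto simp: simplices_def)
  show "?\<tau> y \<in> simplices m N"
    using y \<sigma> by (auto simp: simplices_def intro: permutes_compose)
  show "?\<tau> (?\<tau> y) = y" by (simp add: comp_assoc [symmetric])
  have "vertex c (?\<sigma> \<circ> \<rho>) j = vertex c \<rho> j" if "j \<noteq> i" for j
    using that assms(2) by (auto simp: vertex_def Transposition.transpose_def fun_eq_iff)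
  then show "(case ?\<tau> y of (c, \<rho>) \<Rightarrow> \<psi> (delete_at i (vertex c \<rho>))) =
      (case y of (c, \<rho>) \<Rightarrow> \<psi> (delete_at i (vertex c \<rho>)))"
    by (simp add: delete_at_def cong: if_cong)
  have "?\<sigma> \<circ> \<rho> \<noteq> \<rho>"
  proof
    assume "?\<sigma> \<circ> \<rho> = \<rho>"
    then have "?\<sigma> (\<rho> (inv \<rho> i)) = \<rho> (inv \<rho> i)" by (metis comp_apply)
    then show False using assms(2) permutes_inverses[OF \<rho>] by simp
  qed
  then show "?\<tau> y = y \<Longrightarrow> (case y of (c, \<rho>) \<Rightarrow> \<psi> (delete_at i (vertex c \<rho>))) = 0"
    by simp
qed auto

text \<open>Without vertex 0 the coordinate of rank 0 stays at its odd end. As \<open>N\<close> is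
  even, this end lies strictly inside the box, so the cell beyond it always exists and supplies the
  partner.\<close>

lemma sum_first_facets:
  assumes "even N" and "0 < m"
  shows "(\<Sum>(c, \<rho>)\<in>simplices m N. (\<psi> (delete_at 0 (vertex c \<rho>)) :: bit)) = 0"
proof (rule sum_bit_involution)
  let ?r = "\<lambda>a :: nat. if even a then Suc a else a - 1"
  let ?\<tau> = "\<lambda>(c :: nat \<Rightarrow> nat, \<rho>). (c(inv \<rho> 0 := ?r (c (inv \<rho> 0))), \<rho> :: nat \<Rightarrow> nat)"
  fix y assume y: "y \<in> simplices m N"
  then obtain c \<rho> where [simp]: "y = (c, \<rho>)" and \<rho>: "\<rho> permutes {..<m}"
    and c: "c \<in> {..<m} \<rightarrow>\<^sub>E {..<N}"
    by (auto simp: simplices_def)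
  have k: "inv \<rho> 0 < m" using assms permutes_in_image[OF permutes_inv[OF \<rho>]] by simp
  with c have "c (inv \<rho> 0) < N" by auto
  then have "?r (c (inv \<rho> 0)) < N" using assms(1) by (cases "Suc (c (inv \<rho> 0)) = N") auto
  then show "?\<tau> y \<in> simplices m N"
    using c \<rho> k by (auto simp: simplices_def PiE_iff extensional_def)
  show "?\<tau> (?\<tau> y) = y"
    by (auto simp: fun_eq_iff)
  have [simp]: "even a \<Longrightarrow> odd_end (Suc a) = odd_end a" "odd a \<Longrightarrow> odd_end (a - Suc 0) = odd_end a" for a
    by (auto simp: odd_end_def)
  have "\<rho> l = 0 \<longleftrightarrow> l = inv \<rho> 0" for l
    using permutes_inv_eq[OF \<rho>, of 0 l] by auto
  then have "vertex (c(inv \<rho> 0 := ?r (c (inv \<rho> 0)))) \<rho> (Suc j) = vertex c \<rho> (Suc j)" for j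
    using permutes_inverses[OF \<rho>] by (simp add: vertex_def fun_eq_iff)
  then show "(case ?\<tau> y of (c, \<rho>) \<Rightarrow> \<psi> (delete_at 0 (vertex c \<rho>))) =
      (case y of (c, \<rho>) \<Rightarrow> \<psi> (delete_at 0 (vertex c \<rho>)))"
    by (simp add: delete_at_def)
  have "?r a \<noteq> a" for a by (cases a) auto
  then have "c(inv \<rho> 0 := ?r (c (inv \<rho> 0))) \<noteq> c" by (metis fun_upd_same)
  then have "?\<tau> y \<noteq> y" by (simp only: \<open>y = (c, \<rho>)\<close> prod.case prod.inject simp_thms)
  then show "?\<tau> y = y \<Longrightarrow> (case y of (c, \<rho>) \<Rightarrow> \<psi> (delete_at 0 (vertex c \<rho>))) = 0"
    by blast
qed auto


lemma even_end_reflect: "even N \<Longrightarrow> c < N \<Longrightarrow> even_end (N - Suc c) = N - even_end c"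
  by (auto simp: even_end_def)

lemma odd_end_reflect: "even N \<Longrightarrow> c < N \<Longrightarrow> odd_end (N - Suc c) = N - odd_end c"
  by (auto simp: odd_end_def)

text \<open>Since \<open>\<psi>\<close> sees only the vertices below \<open>m\<close>, the
  coordinate \<open>k\<close> of rank \<open>m - 1\<close> stays at its even end. This end can be
  \<open>0\<close> or \<open>N\<close>, which is where the boundary enters: such facets are paired
  by the gluing if \<open>k \<in> G\<close> and have value zero otherwise.\<close>

lemma sum_last_facets:
  fixes \<psi> :: "(nat \<Rightarrow> nat \<Rightarrow> nat) \<Rightarrow> bit"
  assumes N: "even N" and m: "0 < m"
    and local: "\<And>v w. (\<And>j. j < m \<Longrightarrow> v j = w j) \<Longrightarrow> \<psi> v = \<psi> w"
    and glued: "\<And>v k. \<lbrakk>\<And>i l. i < m \<Longrightarrow> l < m \<Longrightarrow> v i l \<le> N; k < m; k \<in> G; \<And>i. i < m \<Longrightarrow> v i k = 0\<rbrakk>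
      \<Longrightarrow> \<psi> (\<lambda>i. glue \<theta> N m k (v i)) = \<psi> v"
    and null: "\<And>v k. \<lbrakk>\<And>i l. i < m \<Longrightarrow> l < m \<Longrightarrow> v i l \<le> N; k < m; k \<notin> G;
        (\<forall>i<m. v i k = 0) \<or> (\<forall>i<m. v i k = N)\<rbrakk> \<Longrightarrow> \<psi> v = 0"
  shows "(\<Sum>(c, \<rho>)\<in>simplices m N. \<psi> (vertex c \<rho>)) = 0"
proof -
  \<comment> \<open>The cell on the other side of the even end of cell \<open>a\<close>.\<close>
  define r where "r a = (if odd a then Suc a else a - 1)" for a :: nat
  define refl where "refl k c = (\<lambda>l. if l = k \<or> k < l \<and> l < m \<and> \<theta> l k = 1 then N - Suc (c l) else c l)"
    for k :: nat and c :: "nat \<Rightarrow> nat"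
  define step where "step k c = (if 0 < c k \<and> Suc (c k) < N then c(k := r (c k)) else if k \<in> G then refl k c else c)"
    for k :: nat and c :: "nat \<Rightarrow> nat"
  define \<tau> where "\<tau> y = (step (inv (snd y) (m - 1)) (fst y), snd y)" for y :: "(nat \<Rightarrow> nat) \<times> (nat \<Rightarrow> nat)"
  have refl_vertex: "vertex (refl k c) \<rho> i = glue \<theta> N m k (vertex c \<rho> i)"
    if "k < m" "\<And>l. l < m \<Longrightarrow> c l < N" for k c \<rho> i
    using that N by (auto simp: fun_eq_iff vertex_def glue_def refl_def even_end_reflect odd_end_reflect)
  show ?thesis
  proof (rule sum_bit_involution[where \<tau> = \<tau>])
    fix y assume y: "y \<in> simplices m N"
    then obtain c \<rho> where [simp]: "y = (c, \<rho>)" and \<rho>: "\<rho> permutes {..<m}"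
      and c: "c \<in> {..<m} \<rightarrow>\<^sub>E {..<N}"
      by (auto simp: simplices_def)
    define k where "k = inv \<rho> (m - 1)"
    have k: "k < m" using m permutes_in_image[OF permutes_inv[OF \<rho>]] by (simp add: k_def)
    have cN: "l < m \<Longrightarrow> c l < N" for l using c by auto
    have \<tau>_y: "\<tau> (c, \<rho>) = (step k c, \<rho>)" by (simp add: \<tau>_def k_def)
    have r: "0 < r a \<and> Suc (r a) < N" "r (r a) = a" "even_end (r a) = even_end a" "r a \<noteq> a"
      if "0 < a" "Suc a < N" for a
      using that N by (auto simp: r_def even_end_def) presburger+
    have step_in: "step k c \<in> {..<m} \<rightarrow>\<^sub>E {..<N}"
    proof (rule PiE_I)
      fix l assume "l \<in> {..<m}"
      then show "step k c l \<in> {..<N}"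
        using cN[of l] r(1)[of "c k"] by (auto simp: step_def refl_def)
    next
      fix l assume "l \<notin> {..<m}"
      then show "step k c l = undefined"
        using PiE_arb[OF c, of l] k by (cases "l = k") (auto simp: step_def refl_def)
    qed
    then show "\<tau> y \<in> simplices m N"
      using \<rho> by (simp add: \<tau>_y simplices_def)
    have "refl k (refl k c) = c"
    proof
      fix l
      show "refl k (refl k c) l = c l"
        using cN[of l] k by (auto simp: refl_def)
    qed
    moreover have "refl k c k = N - Suc (c k)" by (simp add: refl_def)
    moreover have "N > 0" using cN k by fastforce
    ultimately have "step k (step k c) = c"
    proof (cases "0 < c k \<and> Suc (c k) < N")
      case True
      then show ?thesis using r(1,2)[of "c k"] by (simp add: step_def)
    next
      case False
      moreover have "\<not> (0 < refl k c k \<and> Suc (refl k c k) < N)"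
        using False cN[OF k] \<open>refl k c k = _\<close> by auto
      ultimately show ?thesis using \<open>refl k (refl k c) = c\<close>
        by (cases "k \<in> G") (simp_all only: step_def if_False if_True)
    qed
    then show "\<tau> (\<tau> y) = y" by (simp add: \<tau>_y) (simp add: \<tau>_def k_def)
    have \<rho>k: "\<rho> k = m - 1" by (simp add: k_def permutes_inverses[OF \<rho>])
    have vk: "vertex c \<rho> i k = even_end (c k)" if "i < m" for i
      using that \<rho>k by (auto simp: vertex_def)
    have vN: "vertex c \<rho> i l \<le> N" if "l < m" for i l
      using cN[OF that] by (simp add: vertex_def even_end_le odd_end_le)
    have ends: "even_end (c k) = 0 \<or> even_end (c k) = N" if "\<not> (0 < c k \<and> Suc (c k) < N)"
      using that N cN[OF k] unfolding even_end_def by presburger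
    show "(case \<tau> y of (c, \<rho>) \<Rightarrow> \<psi> (vertex c \<rho>)) = (case y of (c, \<rho>) \<Rightarrow> \<psi> (vertex c \<rho>))"
    proof (cases "0 < c k \<and> Suc (c k) < N")
      case True
      have "\<rho> l = m - 1 \<longleftrightarrow> l = k" for l
        using permutes_inv_eq[OF \<rho>, of "m - 1" l] by (auto simp: k_def)
      then have "vertex (c(k := r (c k))) \<rho> j = vertex c \<rho> j" if "j < m" for j
        using that True r(3)[of "c k"] \<rho>k by (fastforce simp: vertex_def fun_eq_iff)
      then have "\<psi> (vertex (c(k := r (c k))) \<rho>) = \<psi> (vertex c \<rho>)" by (rule local)
      then show ?thesis using True by (simp add: \<tau>_y step_def)
    next
      case nb: False
      show ?thesis
      proof (cases "k \<in> G")
        case True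
        have 0: "vertex (refl k c) \<rho> = (\<lambda>i. glue \<theta> N m k (vertex c \<rho> i))"
          using refl_vertex[of k c \<rho>] k cN by blast
        have "\<psi> (\<lambda>i. glue \<theta> N m k (vertex c \<rho> i)) = \<psi> (vertex c \<rho>)"
        proof (cases "even_end (c k) = 0")
          case True
          then show ?thesis using \<open>k \<in> G\<close> k vN by (intro glued) (auto simp: vk)
        next
          case False
          then have "even_end (c k) = N" using ends \<open>even_end (c k) \<noteq> 0\<close> nb by blast
          \<comment> \<open>The gluing hypothesis speaks of the facet at \<open>0\<close>. On the
            facet at \<open>N\<close> it is applied to the glued simplex, since gluing twice is the
            identity.\<close>
          moreover have "glue \<theta> N m k (glue \<theta> N m k (vertex c \<rho> i)) = vertex c \<rho> i" for i
            using vN k by (auto simp: glue_def fun_eq_iff)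
          moreover have "glue \<theta> N m k (vertex c \<rho> i) l \<le> N" if "l < m" for i l
            using vN[OF that] by (simp add: glue_def)
          ultimately show ?thesis
            using glued[of "\<lambda>i. glue \<theta> N m k (vertex c \<rho> i)" k] \<open>k \<in> G\<close> k
            by (simp add: vk glue_def)
        qed
        moreover have "step k c = refl k c" using nb True by (auto simp: step_def)
        ultimately show ?thesis by (simp add: \<tau>_y 0)
      next
        case False
        then have "step k c = c" using nb by (auto simp: step_def)
        then show ?thesis by (simp add: \<tau>_y)
      qed
    qed
    assume "\<tau> y = y"
    then have "step k c = c" by (simp add: \<tau>_y)
    then have 1: "\<not> (0 < c k \<and> Suc (c k) < N)"
      using r(4)[of "c k"] by (auto simp: step_def fun_eq_iff split: if_splits)
    \<comment> \<open>As \<open>N\<close> is even, no cell is its own reflection, so fixed points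
      occur on unglued facets only.\<close>
    have 2: "k \<notin> G"
    proof
      assume "k \<in> G"
      then have "N - Suc (c k) = c k"
        using 1 \<open>step k c = c\<close> by (auto simp: step_def refl_def dest: fun_cong[of _ _ k])
      then show False using N cN[OF k] by presburger
    qed
    show "(case y of (c, \<rho>) \<Rightarrow> \<psi> (vertex c \<rho>)) = 0"
      using null[of "vertex c \<rho>" k] 2 ends[OF 1] k vN by (auto simp: vk)
  qed simp
qed


text \<open>The two jump products differ by the coboundary of \<open>\<psi>\<close>, the product of
  the first \<open>L\<close> jumps with \<open>t = s L + s' L\<close>. Both last labels change by
  the same amount under a gluing, so \<open>t\<close> and hence \<open>\<psi>\<close> are
  single-valued on the glued box, and the sum of the coboundary over all simplices cancels facet by
  facet.\<close>

lemma jump_count_cong_last: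
  assumes s: "glued_labels (Suc L) M G \<theta> s" and s': "glued_labels (Suc L) M G \<theta> s'"
    and eq: "\<And>j. j < L \<Longrightarrow> s' j = s j"
  shows "jump_count (Suc L) (2 * M) s = jump_count (Suc L) (2 * M) s'"
proof -
  define t where "t x = s L x + s' L x" for x
  define \<psi> where "\<psi> v = jumps s L v * t (v L)" for v
  let ?S = "simplices (Suc L) (2 * M)"
  interpret s: glued_labels "Suc L" M G \<theta> s by (rule s)
  interpret s': glued_labels "Suc L" M G \<theta> s' by (rule s')
  have local: "\<psi> v = \<psi> w" if "\<And>j. j < Suc L \<Longrightarrow> v j = w j" for v w
    using that jumps_cong[of L v w s] by (simp add: \<psi>_def)
  have cancel: "(a + c) + (b + c) = a + b" for a b c :: bit
    by (cases a; cases b; cases c) auto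
  have glued: "\<psi> (\<lambda>i. glue \<theta> (2 * M) (Suc L) k (v i)) = \<psi> v"
    if v: "\<And>i l. i < Suc L \<Longrightarrow> l < Suc L \<Longrightarrow> v i l \<le> 2 * M" and k: "k < Suc L" "k \<in> G"
      and 0: "\<And>i. i < Suc L \<Longrightarrow> v i k = 0" for v k
  proof -
    have sg: "s j (glue \<theta> (2 * M) (Suc L) k (v i)) = s j (v i) + \<theta> j k" if "j < Suc L" "i < Suc L" for i j
      using that k v 0 by (intro s.glue) auto
    have "s' L (glue \<theta> (2 * M) (Suc L) k (v L)) = s' L (v L) + \<theta> L k"
      using k v 0 by (intro s'.glue) auto
    then have "t (glue \<theta> (2 * M) (Suc L) k (v L)) = t (v L)"
      unfolding t_def by (simp only: sg lessI cancel)
    moreover have "jumps s L (\<lambda>i. glue \<theta> (2 * M) (Suc L) k (v i)) = jumps s L v"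
      unfolding jumps_def by (intro prod.cong refl) (simp only: sg lessThan_iff less_SucI Suc_less_eq cancel)
    ultimately show ?thesis by (simp add: \<psi>_def)
  qed
  \<comment> \<open>On an unglued facet both last labels agree if \<open>k = L\<close>, so
    \<open>t\<close> is zero; if \<open>k < L\<close>, label \<open>k\<close> is constant there and
    does not jump.\<close>
  have null: "\<psi> v = 0"
    if v: "\<And>i l. i < Suc L \<Longrightarrow> l < Suc L \<Longrightarrow> v i l \<le> 2 * M" and k: "k < Suc L" "k \<notin> G"
      and ends: "(\<forall>i<Suc L. v i k = 0) \<or> (\<forall>i<Suc L. v i k = 2 * M)" for v k
  proof -
    have eq_s: "s k (v i) = s k (v j)" if "i < Suc L" "j < Suc L" for i j
      using ends
    proof
      assume "\<forall>i<Suc L. v i k = 0"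
      then show ?thesis using s.low[OF k, of "v i"] s.low[OF k, of "v j"] v that by simp
    next
      assume "\<forall>i<Suc L. v i k = 2 * M"
      then show ?thesis using s.high[OF k, of "v i"] s.high[OF k, of "v j"] v that by simp
    qed
    show ?thesis
    proof (cases "k = L")
      case True
      have "s L (v L) = s' L (v L)"
        using ends s.low[OF k, of "v L"] s.high[OF k, of "v L"] s'.low[OF k, of "v L"] s'.high[OF k, of "v L"] v
        unfolding True by auto
      then show ?thesis by (simp add: \<psi>_def t_def)
    next
      case False
      then have "k < L" using k by simp
      then have "s k (v k) + s k (v (Suc k)) = 0" using eq_s[of k "Suc k"] by simp
      then have "jumps s L v = 0"
        using \<open>k < L\<close> unfolding jumps_def by (intro prod_zero) auto
      then show ?thesis by (simp add: \<psi>_def)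
    qed
  qed
  have facets: "(\<Sum>(c, \<rho>)\<in>?S. \<psi> (delete_at i (vertex c \<rho>))) = 0" if "i \<le> Suc L" for i
  proof -
    consider "i = 0" | "0 < i" "i < Suc L" | "i = Suc L" using \<open>i \<le> Suc L\<close> by linarith
    then show ?thesis
    proof cases
      case 1
      then show ?thesis using sum_first_facets[of "2 * M" "Suc L" \<psi>] by simp
    next
      case 2
      then show ?thesis by (intro sum_inner_facets local)
    next
      case 3
      have "\<psi> (delete_at (Suc L) v) = \<psi> v" for v
        by (rule local) (simp add: delete_at_def)
      moreover have "(\<Sum>(c, \<rho>)\<in>?S. \<psi> (vertex c \<rho>)) = 0"
        by (rule sum_last_facets[where G = G and \<theta> = \<theta>]) (simp, simp, (fact local glued null)+)
      ultimately show ?thesis by (simp only: 3)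
    qed
  qed
  \<comment> \<open>The Leibniz rule: the first factor is closed, so only the change of
    \<open>t\<close> along the last edge remains.\<close>
  have key: "(\<Sum>i\<le>Suc L. \<psi> (delete_at i v)) = jumps s (Suc L) v + jumps s' (Suc L) v" for v
  proof -
    have "(\<Sum>i\<le>L. \<psi> (delete_at i v)) = jumps s L v * t (v (Suc L))"
      unfolding sum_jumps_delete_at[of s L v, symmetric] sum_distrib_right
      by (intro sum.cong) (auto simp: \<psi>_def delete_at_def)
    moreover have "\<psi> (delete_at (Suc L) v) = \<psi> v"
      by (rule local) (simp add: delete_at_def)
    moreover have "jumps s' L v = jumps s L v"
      using eq by (simp add: jumps_def)
    moreover have "r * (b + b') + r * (a + a') = r * (a + b) + r * (a' + b')" for r a b a' b' :: bit
      by (cases r; cases a; cases b; cases a'; cases b') auto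
    ultimately show ?thesis
      by (simp only: sum.atMost_Suc jumps_Suc) (simp only: \<psi>_def t_def)
  qed
  have "0 = (\<Sum>i\<le>Suc L. \<Sum>(c, \<rho>)\<in>?S. \<psi> (delete_at i (vertex c \<rho>)))"
    using facets by simp
  also have "\<dots> = (\<Sum>(c, \<rho>)\<in>?S. \<Sum>i\<le>Suc L. \<psi> (delete_at i (vertex c \<rho>)))"
    by (subst sum.swap) (simp add: case_prod_unfold)
  also have "\<dots> = jump_count (Suc L) (2 * M) s + jump_count (Suc L) (2 * M) s'"
    by (simp only: key jump_count_def case_prod_unfold sum.distrib)
  finally show ?thesis
    by (metis bit_add_left_self add.right_neutral)
qed

text \<open>Replacing the last label by one that jumps only across the slice \<open>x L = M\<close> turns the count
  into the one for the remaining labels on that slice.\<close>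

theorem jump_count_eq_1:
  assumes "glued_labels m M G \<theta> s"
  shows "jump_count m (2 * M) s = 1"
  using assms
proof (induction m arbitrary: s)
  case 0
  have "simplices 0 (2 * M) = {(\<lambda>_. undefined, id)}"
    by (auto simp: simplices_def)
  then show ?case by (simp add: jump_count_def jumps_def)
next
  case (Suc L)
  interpret glued_labels "Suc L" M G \<theta> s by (rule Suc.prems)
  \<comment> \<open>Constant on either side of the slice, so that the last jump is confined to edges
    touching it. On the slice \<open>t\<close> remains \<open>s L\<close>, in order to flip
    correctly under the gluings of facets \<open>k < L\<close>, which map the slice to
    itself.\<close>
  define t :: "(nat \<Rightarrow> nat) \<Rightarrow> bit" where "t x = (if x L < M then 0 else if M < x L then 1 else s L x)" for x
  define s' where "s' j x = s j (x(L := M))" for j x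
  let ?s = "s(L := t)" and ?N = "2 * M"
  have "glued_labels (Suc L) M G \<theta> ?s"
  proof
    fix j k :: nat and x :: "nat \<Rightarrow> nat"
    assume jk: "j < Suc L" "k < Suc L" "k \<in> G" and x: "\<And>l. l < Suc L \<Longrightarrow> x l \<le> ?N" and 0: "x k = 0"
    show "?s j (glue \<theta> ?N (Suc L) k x) = ?s j x + \<theta> j k"
    proof (cases "j = L")
      case True
      have g: "s L (glue \<theta> ?N (Suc L) k x) = s L x + \<theta> L k"
        using jk x 0 by (intro glue) auto
      show ?thesis
      proof (cases "k = L")
        case True
        then have "t x = 0" "t (glue \<theta> ?N (Suc L) k x) = 1"
          using 0 M by (auto simp: t_def glue_def)
        then show ?thesis using True \<open>j = L\<close> diag jk by simp
      next
        case False
        \<comment> \<open>Coordinate \<open>L\<close> is reflected exactly if label \<open>L\<close>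
          flips across facet \<open>k\<close>, so exchanging the two sides of the slice agrees with
          the required change of \<open>t\<close>.\<close>
        then have "glue \<theta> ?N (Suc L) k x L = (if \<theta> L k = 1 then ?N - x L else x L)"
          using jk by (auto simp: glue_def)
        moreover have "\<theta> L k = 0 \<or> \<theta> L k = 1" by (cases "\<theta> L k") auto
        ultimately show ?thesis
          using \<open>j = L\<close> g x[of L] by (auto simp: t_def)
      qed
    next
      case False
      have "s j (glue \<theta> ?N (Suc L) k x) = s j x + \<theta> j k"
        using jk x 0 by (intro glue) auto
      then show ?thesis by (simp only: fun_upd_other[OF False])
    qed
  next
    fix k :: nat and x :: "nat \<Rightarrow> nat"
    assume "k < Suc L" "k \<notin> G" "\<And>l. l < Suc L \<Longrightarrow> x l \<le> ?N"
    then show "x k = 0 \<Longrightarrow> ?s k x = 0" "x k = ?N \<Longrightarrow> ?s k x = 1"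
      using low[of k x] high[of k x] M by (auto simp: t_def)
  qed (use M diag in auto)
  then have "jump_count (Suc L) ?N s = jump_count (Suc L) ?N ?s"
    by (intro jump_count_cong_last[OF Suc.prems]) auto
  also have "\<dots> = jump_count L ?N s'"
  proof -
    \<comment> \<open>A simplex of the slice together with the cell below or above it. Coordinate
      \<open>L\<close> gets the last rank, so all vertices but the last lie in the slice.\<close>
    define ext where "ext = (\<lambda>((c, \<rho>), a). (c(L := a), \<rho>) :: (nat \<Rightarrow> nat) \<times> (nat \<Rightarrow> nat))"
    let ?T = "simplices L ?N \<times> {M - 1, M}"
    have inj: "inj_on ext ?T"
    proof (rule inj_onI)
      fix p q assume pq: "p \<in> ?T" "q \<in> ?T" "ext p = ext q"
      obtain c \<rho> a c' \<rho>' a' where [simp]: "p = ((c, \<rho>), a)" "q = ((c', \<rho>'), a')"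
        by (metis prod.exhaust)
      have e: "c(L := a) = c'(L := a')" "\<rho> = \<rho>'" using pq by (auto simp: ext_def)
      have "c L = undefined" "c' L = undefined"
        using pq PiE_arb[of c "{..<L}" "\<lambda>_. {..<?N}" L] PiE_arb[of c' "{..<L}" "\<lambda>_. {..<?N}" L]
        by (simp_all add: simplices_def)
      then have "c = c'" using e(1) by (metis fun_upd_triv fun_upd_upd)
      moreover have "a = a'" using e(1) by (metis fun_upd_same)
      ultimately show "p = q" using e by simp
    qed
    have sub: "ext ` ?T \<subseteq> simplices (Suc L) ?N"
    proof -
      have "\<rho> permutes {..<Suc L}" if "\<rho> permutes {..<L}" for \<rho>
        using that by (rule permutes_subset) auto
      then show ?thesis
        using M by (auto simp: ext_def simplices_def PiE_iff extensional_def less_Suc_eq)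
    qed
    \<comment> \<open>The last edge moves coordinate \<open>L\<close> only if this coordinate has
      the last rank, and it then meets level \<open>M\<close> only in the cells \<open>M - 1\<close>
      and \<open>M\<close>. Otherwise both of its ends lie strictly on one side of the
      slice.\<close>
    have zero: "jumps ?s (Suc L) (vertex c \<rho>) = 0"
      if mem: "(c, \<rho>) \<in> simplices (Suc L) ?N - ext ` ?T" for c \<rho>
    proof -
      have c: "c \<in> {..<Suc L} \<rightarrow>\<^sub>E {..<?N}" and \<rho>: "\<rho> permutes {..<Suc L}"
        using mem by (auto simp: simplices_def)
      have \<rho>L: "\<rho> L < Suc L" using permutes_in_image[OF \<rho>, of L] by simp
      have "t (vertex c \<rho> L) = t (vertex c \<rho> (Suc L))"
      proof (cases "\<rho> L = L")
        case False
        then have "vertex c \<rho> L L = odd_end (c L)" "vertex c \<rho> (Suc L) L = odd_end (c L)"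
          using \<rho>L by (auto simp: vertex_def)
        moreover have "odd (odd_end (c L))" by (simp add: odd_end_def)
        then have "odd_end (c L) \<noteq> M" using M by auto
        ultimately show ?thesis by (simp add: t_def)
      next
        case True
        have "c L \<noteq> M - 1 \<and> c L \<noteq> M"
        proof (rule ccontr)
          assume "\<not> ?thesis"
          then have a: "c L \<in> {M - 1, M}" by auto
          have "\<rho> permutes {..<L}"
            using \<rho> by (rule permutes_superset) (auto simp: less_Suc_eq True)
          moreover have "c(L := undefined) \<in> {..<L} \<rightarrow>\<^sub>E {..<?N}"
            using c by (auto simp: PiE_iff extensional_def)
          ultimately have "((c(L := undefined), \<rho>), c L) \<in> ?T"
            using a by (simp add: simplices_def)
          then have "ext ((c(L := undefined), \<rho>), c L) \<in> ext ` ?T" by (rule imageI)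
          then show False using mem by (simp add: ext_def)
        qed
        then have "even_end (c L) < M \<and> odd_end (c L) < M \<or> M < even_end (c L) \<and> M < odd_end (c L)"
          using M by (auto simp: even_end_def odd_end_def)
        moreover have "vertex c \<rho> L L = even_end (c L)" "vertex c \<rho> (Suc L) L = odd_end (c L)"
          using True by (auto simp: vertex_def)
        ultimately show ?thesis by (auto simp: t_def)
      qed
      then show ?thesis by (simp add: jumps_Suc)
    qed
    \<comment> \<open>The two simplices share their vertices in the slice, and \<open>t\<close> is 0
      at one of the remaining vertices and 1 at the other. So exactly one of the two last edges
      jumps.\<close>
    have two: "(\<Sum>a\<in>{M - 1, M}. jumps ?s (Suc L) (vertex (c(L := a)) \<rho>)) = jumps s' L (vertex c \<rho>)"
      if "(c, \<rho>) \<in> simplices L ?N" for c \<rho>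
    proof -
      have \<rho>L: "\<rho> L = L" using that by (auto simp: simplices_def intro: permutes_not_in)
      have ends: "even_end a = M" if "a \<in> {M - 1, M}" for a
        using that M by (auto simp: even_end_def)
      have v: "vertex (c(L := a)) \<rho> i = (vertex c \<rho> i)(L := M)" if "a \<in> {M - 1, M}" "i \<le> L" for a i
        using ends[OF that(1)] that(2) \<rho>L by (auto simp: vertex_def fun_eq_iff)
      have j: "jumps ?s L (vertex (c(L := a)) \<rho>) = jumps s' L (vertex c \<rho>)" if "a \<in> {M - 1, M}" for a
        unfolding jumps_def by (intro prod.cong) (auto simp: v[OF that] s'_def)
      have "vertex (c(L := a)) \<rho> (Suc L) L = odd_end a" for a
        using \<rho>L by (simp add: vertex_def)
      then have "t (vertex (c(L := M - 1)) \<rho> (Suc L)) = 0" "t (vertex (c(L := M)) \<rho> (Suc L)) = 1"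
        using M by (auto simp: t_def odd_end_def)
      moreover have "t (vertex (c(L := a)) \<rho> L) = s L ((vertex c \<rho> L)(L := M))" if "a \<in> {M - 1, M}" for a
        using v[OF that, of L] by (simp add: t_def)
      moreover have "r * (x + 0) + r * (x + 1) = r" for r x :: bit
        by (cases r; cases x) auto
      moreover have "M - 1 \<noteq> M" using M by simp
      ultimately show ?thesis
        by (simp only: sum.insert finite.intros insert_iff empty_iff simp_thms sum.empty add_0_right
            jumps_Suc j fun_upd_same insertI1 insertI2)
    qed
    have "jump_count (Suc L) ?N ?s = (\<Sum>(c, \<rho>)\<in>ext ` ?T. jumps ?s (Suc L) (vertex c \<rho>))"
      unfolding jump_count_def using sub zero by (intro sum.mono_neutral_right) auto
    also have "\<dots> = (\<Sum>((c, \<rho>), a)\<in>?T. jumps ?s (Suc L) (vertex (c(L := a)) \<rho>))"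
      by (subst sum.reindex[OF inj]) (simp add: ext_def case_prod_unfold)
    also have "\<dots> = (\<Sum>(c, \<rho>)\<in>simplices L ?N. \<Sum>a\<in>{M - 1, M}. jumps ?s (Suc L) (vertex (c(L := a)) \<rho>))"
      by (simp only: sum.cartesian_product case_prod_unfold)
    also have "\<dots> = jump_count L ?N s'"
      unfolding jump_count_def using two by (intro sum.cong) auto
    finally show ?thesis .
  qed
  also have "\<dots> = 1"
  proof (rule Suc.IH)
    have comm: "(glue \<theta> ?N L k x)(L := M) = glue \<theta> ?N (Suc L) k (x(L := M))" if "k < L" for k x
      using that by (auto simp: glue_def fun_eq_iff)
    show "glued_labels L M G \<theta> s'"
    proof
      fix j k :: nat and x :: "nat \<Rightarrow> nat"
      assume "j < L" "k < L" "k \<in> G" and "\<And>l. l < L \<Longrightarrow> x l \<le> ?N" and "x k = 0"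
      then have "s j (glue \<theta> ?N (Suc L) k (x(L := M))) = s j (x(L := M)) + \<theta> j k"
        by (intro glue) (auto simp: less_Suc_eq)
      then show "s' j (glue \<theta> ?N L k x) = s' j x + \<theta> j k"
        by (simp only: s'_def comm[OF \<open>k < L\<close>])
    next
      fix k :: nat and x :: "nat \<Rightarrow> nat"
      assume "k < L" "k \<notin> G" "\<And>l. l < L \<Longrightarrow> x l \<le> ?N"
      then show "x k = 0 \<Longrightarrow> s' k x = 0" "x k = ?N \<Longrightarrow> s' k x = 1"
        by (auto simp: s'_def less_Suc_eq intro!: low high)
    qed (use M diag in auto)
  qed
  finally show ?case .
qed

corollary ex_simplex_with_all_jumps:
  assumes "glued_labels m M G \<theta> s"
  shows "\<exists>c \<rho>. (c, \<rho>) \<in> simplices m (2 * M) \<and> (\<forall>j<m. s j (vertex c \<rho> j) \<noteq> s j (vertex c \<rho> (Suc j)))"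
proof -
  obtain c \<rho> where c: "(c, \<rho>) \<in> simplices m (2 * M)" and "jumps s m (vertex c \<rho>) \<noteq> 0"
    using jump_count_eq_1[OF assms] unfolding jump_count_def
    by (metis (mono_tags, lifting) case_prod_conv old.prod.exhaust sum.neutral zero_neq_one)
  then have "s j (vertex c \<rho> j) + s j (vertex c \<rho> (Suc j)) \<noteq> 0" if "j < m" for j
    using that by (simp only: jumps_def prod_zero_iff finite_lessThan) blast
  then show ?thesis using c by fastforce
qed

section \<open>Common zeros on glued boxes and on frames\<close>

text \<open>An infinite product, so that one type serves every dimension \<open>m\<close>. It is
  compact by Tychonoff, and convergence is coordinatewise.\<close>

definition unit_box :: "(nat \<Rightarrow> real) set" where
  "unit_box = {y. \<forall>l. y l \<in> {0..1}}"

lemma compact_unit_box: "compact unit_box"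
proof -
  have "compactin (product_topology (\<lambda>_. euclidean) UNIV) (PiE UNIV (\<lambda>_::nat. {0..1::real}))"
    by (simp add: compactin_PiE)
  then show ?thesis
    by (simp add: unit_box_def euclidean_product_topology PiE_UNIV_domain Pi_def)
qed

lemma tendsto_componentwise:
  fixes g :: "nat \<Rightarrow> 'b \<Rightarrow> 'c::topological_space"
  shows "g \<longlonglongrightarrow> y \<longleftrightarrow> (\<forall>l. (\<lambda>n. g n l) \<longlonglongrightarrow> y l)"
  using limitin_componentwise[of "\<lambda>_. euclidean" UNIV g y sequentially]
  by (simp add: euclidean_product_topology)

text \<open>\<open>e\<close> breaks ties where \<open>f\<close> vanishes at grid points.\<close>

theorem common_zero_on_glued_box:
  fixes f :: "nat \<Rightarrow> (nat \<Rightarrow> real) \<Rightarrow> real" and e :: "nat \<Rightarrow> (nat \<Rightarrow> real) \<Rightarrow> bit"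
  assumes cont: "\<And>j. j < m \<Longrightarrow> continuous_on unit_box (f j)"
    and diag: "\<And>k. k < m \<Longrightarrow> k \<in> G \<Longrightarrow> \<theta> k k = 1"
    and glue_f: "\<And>j k y. \<lbrakk>j < m; k < m; k \<in> G; y \<in> unit_box; y k = 0\<rbrakk>
      \<Longrightarrow> f j (glue \<theta> 1 m k y) = (if \<theta> j k = 1 then - f j y else f j y)"
    and glue_e: "\<And>j k y. \<lbrakk>j < m; k < m; k \<in> G; y \<in> unit_box; y k = 0\<rbrakk>
      \<Longrightarrow> e j (glue \<theta> 1 m k y) = e j y + \<theta> j k"
    and low: "\<And>k y. \<lbrakk>k < m; k \<notin> G; y \<in> unit_box; y k = 0\<rbrakk> \<Longrightarrow> f k y < 0"
    and high: "\<And>k y. \<lbrakk>k < m; k \<notin> G; y \<in> unit_box; y k = 1\<rbrakk> \<Longrightarrow> 0 < f k y"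
  shows "\<exists>y\<in>unit_box. \<forall>j<m. f j y = 0"
proof -
  define pt where "pt M x = (\<lambda>l. if l < m then real (x l) / real (2 * M) else 0)" for M :: nat and x :: "nat \<Rightarrow> nat"
  have pt_B: "pt M x \<in> unit_box" if "0 < M" "\<And>l. l < m \<Longrightarrow> x l \<le> 2 * M" for M x
    using that(2) that(1) unfolding unit_box_def pt_def by (auto simp: divide_simps) (metis of_nat_le_iff of_nat_mult of_nat_numeral)
  have step: "\<exists>v. (\<forall>j\<le>m. v j \<in> unit_box \<and> (\<forall>l. \<bar>v j l - v 0 l\<bar> \<le> 1 / real (Suc n))) \<and> (\<forall>j<m. f j (v j) * f j (v (Suc j)) \<le> 0)" for n
  proof -
    define M where "M = 2 * Suc n"
    have M: "even M" "0 < M" by (auto simp: M_def)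
    define s where "s j x = (if 0 < f j (pt M x) then 1 else if f j (pt M x) < 0 then 0 else e j (pt M x))" for j x
    have pt_glue: "pt M (glue \<theta> (2 * M) m k x) = glue \<theta> 1 m k (pt M x)"
      if "k < m" "\<And>l. l < m \<Longrightarrow> x l \<le> 2 * M" for k x
      using that M(2) by (auto simp: pt_def glue_def fun_eq_iff of_nat_diff divide_simps)
    have "glued_labels m M G \<theta> s"
    proof
      fix j k :: nat and x :: "nat \<Rightarrow> nat"
      assume jk: "j < m" "k < m" "k \<in> G" and x: "\<And>l. l < m \<Longrightarrow> x l \<le> 2 * M" and 0: "x k = 0"
      have y: "pt M x \<in> unit_box" "pt M x k = 0" using pt_B[OF M(2) x] 0 by (auto simp: pt_def)
      have 1: "\<theta> j k = 0 \<or> \<theta> j k = 1" by (cases "\<theta> j k") auto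
      show "s j (glue \<theta> (2 * M) m k x) = s j x + \<theta> j k"
        using 1 glue_f[OF jk y] glue_e[OF jk y] by (auto simp: s_def pt_glue[OF jk(2) x])
    next
      fix k :: nat and x :: "nat \<Rightarrow> nat"
      assume k: "k < m" "k \<notin> G" and x: "\<And>l. l < m \<Longrightarrow> x l \<le> 2 * M"
      have y: "pt M x \<in> unit_box" using pt_B[OF M(2) x] .
      show "s k x = 0" if "x k = 0"
      proof -
        have "pt M x k = 0" using that by (simp add: pt_def)
        then show ?thesis using low[OF k y] by (simp add: s_def)
      qed
      show "s k x = 1" if "x k = 2 * M"
      proof -
        have "pt M x k = 1" using that k M(2) by (simp add: pt_def)
        then show ?thesis using high[OF k y] by (simp add: s_def)
      qed
    qed (use M diag in auto)
    from ex_simplex_with_all_jumps[OF this] obtain c \<rho> where c: "(c, \<rho>) \<in> simplices m (2 * M)"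
      and jump: "\<And>j. j < m \<Longrightarrow> s j (vertex c \<rho> j) \<noteq> s j (vertex c \<rho> (Suc j))"
      by blast
    define v where "v j = pt M (vertex c \<rho> j)" for j
    have "v j \<in> unit_box" for j
      unfolding v_def using M(2) vertex_le[OF c] by (intro pt_B)
    moreover have "\<bar>v j l - v 0 l\<bar> \<le> 1 / real (Suc n)" for j l
    proof -
      have "\<bar>real (vertex c \<rho> j l) - real (vertex c \<rho> 0 l)\<bar> \<le> 1"
        by (auto simp: vertex_def odd_end_def even_end_def)
      then have "\<bar>v j l - v 0 l\<bar> \<le> 1 / real (2 * M)"
        by (auto simp: v_def pt_def divide_simps simp flip: diff_divide_distrib)
      also have "\<dots> \<le> 1 / real (Suc n)"
        by (rule divide_left_mono) (auto simp: M_def)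
      finally show ?thesis .
    qed
    moreover have "f j (v j) * f j (v (Suc j)) \<le> 0" if "j < m" for j
      using jump[OF that] by (auto simp: s_def v_def mult_le_0_iff split: if_splits)
    ultimately show ?thesis by blast
  qed
  then obtain v where vB: "\<And>n j. j \<le> m \<Longrightarrow> v n j \<in> unit_box"
    and near: "\<And>n j l. j \<le> m \<Longrightarrow> \<bar>v n j l - v n 0 l\<bar> \<le> 1 / real (Suc n)"
    and sign: "\<And>n j. j < m \<Longrightarrow> f j (v n j) * f j (v n (Suc j)) \<le> 0"
    by metis
  have "seq_compact unit_box"
    by (rule compact_imp_seq_compact[OF compact_unit_box])
  moreover have "\<forall>n. v n 0 \<in> unit_box" using vB by auto
  ultimately obtain y r where y: "y \<in> unit_box" and r: "strict_mono r" and lim: "((\<lambda>n. v n 0) \<circ> r) \<longlonglongrightarrow> y"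
    by (rule seq_compactE)
  have vlim: "(\<lambda>n. v (r n) j) \<longlonglongrightarrow> y" if "j \<le> m" for j
    unfolding tendsto_componentwise
  proof
    fix l
    have "(\<lambda>n. v (r n) 0 l) \<longlonglongrightarrow> y l"
      using lim unfolding tendsto_componentwise by (simp add: comp_def)
    moreover have "(\<lambda>n. v (r n) j l - v (r n) 0 l) \<longlonglongrightarrow> 0"
    proof (rule tendsto_0_le[where K = 1])
      show "(\<lambda>n. inverse (real (Suc (r n)))) \<longlonglongrightarrow> 0"
        using LIMSEQ_subseq_LIMSEQ[OF LIMSEQ_inverse_real_of_nat r] by (simp add: comp_def)
      show "\<forall>\<^sub>F n in sequentially. norm (v (r n) j l - v (r n) 0 l) \<le> norm (inverse (real (Suc (r n)))) * 1"
        using near[OF that] by (intro always_eventually) (simp add: inverse_eq_divide)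
    qed
    ultimately have "(\<lambda>n. v (r n) 0 l + (v (r n) j l - v (r n) 0 l)) \<longlonglongrightarrow> y l + 0"
      by (rule tendsto_add)
    then show "(\<lambda>n. v (r n) j l) \<longlonglongrightarrow> y l" by simp
  qed
  \<comment> \<open>Two vertices of shrinking simplices carry values of \<open>f j\<close> with
    nonpositive product, and both converge to \<open>y\<close>; hence the square of
    \<open>f j y\<close> is at most zero.\<close>
  have "f j y = 0" if "j < m" for j
  proof -
    have "(\<lambda>n. f j (v (r n) i)) \<longlonglongrightarrow> f j y" if "i \<le> m" for i
      by (rule continuous_on_tendsto_compose[OF cont[OF \<open>j < m\<close>] vlim[OF that] y])
        (use vB that in auto)
    then have "(\<lambda>n. f j (v (r n) j) * f j (v (r n) (Suc j))) \<longlonglongrightarrow> f j y * f j y"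
      using that by (intro tendsto_mult) auto
    then have "f j y * f j y \<le> 0"
      by (rule LIMSEQ_le_const2) (use sign[OF that] in auto)
    then show ?thesis by (auto simp: mult_le_0_iff)
  qed
  then show ?thesis using y by blast
qed


text \<open>All angles \<open>pi * y l\<close> range over a half turn, so on the unit box coordinate
  0 is nonnegative: the box parametrizes a hemisphere of the \<open>n\<close>-sphere, which
  represents the sphere modulo the antipodal map.\<close>

definition spherical :: "nat \<Rightarrow> (nat \<Rightarrow> real) \<Rightarrow> nat \<Rightarrow> real" where
  "spherical n y i = (if i = 0 then 1 else cos (pi * y (i - 1))) * (\<Prod>l\<in>{i..<n}. sin (pi * y l))"

lemma sum_spherical_squares: "(\<Sum>i\<le>n. (spherical n y i)\<^sup>2) = 1"
proof (induction n)
  case 0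
  then show ?case by (simp add: spherical_def)
next
  case (Suc n)
  have "(\<Sum>i\<le>n. (spherical (Suc n) y i)\<^sup>2) = (\<Sum>i\<le>n. (spherical n y i)\<^sup>2) * (sin (pi * y n))\<^sup>2"
    unfolding sum_distrib_right
    by (intro sum.cong refl) (simp add: spherical_def power_mult_distrib)
  then show ?case by (simp add: Suc) (simp add: spherical_def)
qed

lemma spherical_cong: "(\<And>l. l < n \<Longrightarrow> y l = z l) \<Longrightarrow> i \<le> n \<Longrightarrow> spherical n y i = spherical n z i"
  by (auto simp: spherical_def)

text \<open>Where \<open>y k = 0\<close>, the coordinates up to \<open>k\<close> contain the factor
  \<open>sin (pi * y k) = 0\<close>. In the others the reflection preserves every sine and negates
  the single cosine.\<close>

lemma spherical_glue:
  assumes "k < n" "i \<le> n" "y k = 0" and z: "\<And>l. l < n \<Longrightarrow> z l = (if k \<le> l then 1 - y l else y l)"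
  shows "spherical n z i = - spherical n y i"
proof (cases "i \<le> k")
  case True
  have "(\<Prod>l\<in>{i..<n}. sin (pi * y l)) = 0" "(\<Prod>l\<in>{i..<n}. sin (pi * z l)) = 0"
    using assms True by (auto intro!: bexI[of _ k])
  then show ?thesis by (simp only: spherical_def mult_zero_right minus_zero)
next
  case False
  have "(\<Prod>l\<in>{i..<n}. sin (pi * z l)) = (\<Prod>l\<in>{i..<n}. sin (pi * y l))"
    using False z by (intro prod.cong) (auto simp: right_diff_distrib sin_diff)
  moreover have "cos (pi * z (i - 1)) = - cos (pi * y (i - 1))"
    using False z[of "i - 1"] assms by (auto simp: right_diff_distrib cos_diff)
  ultimately show ?thesis using False by (simp add: spherical_def)
qed

lemma continuous_on_spherical:
  fixes g :: "'a::t2_space \<Rightarrow> nat \<Rightarrow> real"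
  assumes "\<And>l. continuous_on S (\<lambda>y. g y l)"
  shows "continuous_on S (\<lambda>y. spherical n (g y) i)"
proof -
  have 0: "continuous_on S (\<lambda>y. sin (pi * g y l))" for l
    by (intro continuous_on_mult continuous_on_sin continuous_on_const assms)
  have 1: "continuous_on S (\<lambda>y. cos (pi * g y l))" for l
    by (intro continuous_on_mult continuous_on_cos continuous_on_const assms)
  have 2: "continuous_on S (\<lambda>y. \<Prod>l\<in>{i..<n}. sin (pi * g y l))"
    by (intro continuous_on_prod 0)
  show ?thesis
    unfolding spherical_def using 2 continuous_on_mult[OF 1 2] by (cases "i = 0") simp_all
qed

definition frames :: "('a::euclidean_space \<times> 'a \<times> real \<times> real \<times> real) set" where
  "frames = {(u, v, r, s, z). norm u = 1 \<and> norm v = 1 \<and> u \<bullet> v = 0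
     \<and> r \<in> {-1..1} \<and> s \<in> {-1..1} \<and> z \<in> {-1..1}}"

text \<open>Parities of the \<open>2 n + 3\<close> equations under the two sign changes: the first \<open>n\<close> are matched with the
  spherical coordinates of \<open>v\<close>, the next \<open>n\<close> with those of \<open>u\<close> and the last three with \<open>r\<close>, \<open>s\<close>, \<open>z\<close>.\<close>

definition u_odd :: "nat \<Rightarrow> nat \<Rightarrow> bool" where
  "u_odd n j \<longleftrightarrow> n \<le> j + 1 \<and> j \<noteq> 2 * n + 1"

definition v_odd :: "nat \<Rightarrow> nat \<Rightarrow> bool" where
  "v_odd n j \<longleftrightarrow> j < n \<or> j = 2 * n + 1 \<or> j = 2 * n + 2"

text \<open>The orthogonality of \<open>u\<close> and \<open>v\<close> is imposed as the equation with index \<open>n - 1\<close>, which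
  is odd in both vectors; the given functions are cut off away from it.\<close>

theorem common_zero_on_frames:
  fixes F :: "nat \<Rightarrow> 'a::euclidean_space \<times> 'a \<times> real \<times> real \<times> real \<Rightarrow> real"
  assumes dim: "DIM('a) = Suc n" and n: "0 < n"
    and cont: "\<And>j. j < 2 * n + 3 \<Longrightarrow> continuous_on frames (F j)"
    and F_u: "\<And>j u v r s z. \<lbrakk>j < 2 * n + 3; (u, v, r, s, z) \<in> frames\<rbrakk>
      \<Longrightarrow> F j (- u, v, - r, s, - z) = (if u_odd n j then - F j (u, v, r, s, z) else F j (u, v, r, s, z))"
    and F_v: "\<And>j u v r s z. \<lbrakk>j < 2 * n + 3; (u, v, r, s, z) \<in> frames\<rbrakk>
      \<Longrightarrow> F j (u, - v, r, - s, - z) = (if v_odd n j then - F j (u, v, r, s, z) else F j (u, v, r, s, z))"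
    and r_low: "\<And>u v s z. (u, v, -1, s, z) \<in> frames \<Longrightarrow> F (2 * n) (u, v, -1, s, z) < 0"
    and r_high: "\<And>u v s z. (u, v, 1, s, z) \<in> frames \<Longrightarrow> 0 < F (2 * n) (u, v, 1, s, z)"
    and s_low: "\<And>u v r z. (u, v, r, -1, z) \<in> frames \<Longrightarrow> F (2 * n + 1) (u, v, r, -1, z) < 0"
    and s_high: "\<And>u v r z. (u, v, r, 1, z) \<in> frames \<Longrightarrow> 0 < F (2 * n + 1) (u, v, r, 1, z)"
    and z_low: "\<And>u v r s. (u, v, r, s, -1) \<in> frames \<Longrightarrow> F (2 * n + 2) (u, v, r, s, -1) < 0"
    and z_high: "\<And>u v r s. (u, v, r, s, 1) \<in> frames \<Longrightarrow> 0 < F (2 * n + 2) (u, v, r, s, 1)"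
  shows "\<exists>p\<in>frames. \<forall>j<2 * n + 3. j \<noteq> n - 1 \<longrightarrow> F j p = 0"
proof -
  define m where "m = 2 * n + 3"
  \<comment> \<open>Facets of the angles of \<open>v\<close> negate \<open>v\<close>, those of the
    angles of \<open>u\<close> negate \<open>u\<close>. Equation \<open>n - 1\<close> is odd in both
    vectors, but its coordinate precedes all angles of \<open>u\<close>, so the facets of
    \<open>u\<close> leave \<open>v\<close> fixed.\<close>
  define \<theta> :: "nat \<Rightarrow> nat \<Rightarrow> bit" where "\<theta> j k = of_bool (if k < n then v_odd n j else u_odd n j)" for j k
  have \<theta>_iff: "\<theta> j k = 1 \<longleftrightarrow> (if k < n then v_odd n j else u_odd n j)" for j k by (simp add: \<theta>_def)
  have "card {..n} = card (Basis :: 'a set)" using dim by simp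
  then obtain b :: "nat \<Rightarrow> 'a" where b: "bij_betw b {..n} Basis"
    by (metis finite_Basis finite_atMost finite_same_card_bij)
  have b_inner: "b i \<bullet> b j = of_bool (i = j)" if "i \<le> n" "j \<le> n" for i j
    using that b bij_betw_imp_inj_on[OF b] by (auto simp: inner_Basis bij_betwE inj_on_eq_iff)
  define sph where "sph y = (\<Sum>i\<le>n. spherical n y i *\<^sub>R b i)" for y
  have "sph y \<bullet> sph y = 1" for y
  proof -
    have "sph y \<bullet> sph y = (\<Sum>i\<le>n. \<Sum>j\<le>n. spherical n y i * (spherical n y j * (b j \<bullet> b i)))"
      by (simp add: sph_def inner_sum_left inner_sum_right sum_distrib_left)
    also have "\<dots> = (\<Sum>i\<le>n. \<Sum>j\<le>n. if i = j then spherical n y i * spherical n y j else 0)"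
      by (intro sum.cong refl) (simp add: b_inner)
    also have "\<dots> = 1"
      using sum_spherical_squares[of n y] by (simp add: power2_eq_square)
    finally show ?thesis .
  qed
  then have norm_sph: "norm (sph y) = 1" for y by (simp add: norm_eq_1)
  define U where "U y = sph (\<lambda>l. y (n + l))" for y
  define V where "V y = sph y" for y
  have cont_pr: "continuous_on S (\<lambda>y :: nat \<Rightarrow> real. y l)" for S l
    by (rule continuous_on_subset[OF continuous_on_product_coordinates]) auto
  have cont_U: "continuous_on unit_box U" and cont_V: "continuous_on unit_box V"
    unfolding U_def V_def sph_def by (auto intro!: continuous_intros continuous_on_spherical cont_pr)
  define tl where "tl y = (2 * y (2 * n) - 1, 2 * y (2 * n + 1) - 1, 2 * y (2 * n + 2) - 1)" for y :: "nat \<Rightarrow> real"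
  \<comment> \<open>For unit vectors, this is 1 exactly at orthogonality and 0 once
    \<open>\<bar>u \<bullet> v\<bar>\<close> reaches \<open>1 / 2\<close>, well before the
    Gram-Schmidt vector \<open>orth u v\<close> degenerates at \<open>v = u\<close> or
    \<open>v = - u\<close>.\<close>
  define lam where "lam u v = max 0 (1 - 2 * \<bar>u \<bullet> v\<bar>)" for u v :: 'a
  define orth where "orth u v = v - (u \<bullet> v) *\<^sub>R u" for u v :: 'a
  \<comment> \<open>Away from orthogonality the functions fade into the bare coordinates
    \<open>r\<close>, \<open>s\<close>, \<open>z\<close> or into zero, which have the right parities
    and, for the last three equations, the required signs at both ends.\<close>
  define H where "H j u v t = (if j = n - 1 then u \<bullet> v else lam u v * F j (u, sgn (orth u v), t) + (1 - lam u v) *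
      (case t of (r, s, z) \<Rightarrow> if j = 2 * n then r else if j = 2 * n + 1 then s else if j = 2 * n + 2 then z else 0))"
    for j u v t
  have orth_frame: "(u, sgn (orth u v), t) \<in> frames"
    if "norm u = 1" "norm v = 1" "\<bar>u \<bullet> v\<bar> < 1" "t \<in> {-1..1} \<times> {-1..1} \<times> {-1..1}" for u v t
  proof -
    have "u \<bullet> u = 1" using that(1) by (simp add: norm_eq_1)
    have "orth u v \<noteq> 0"
    proof
      assume "orth u v = 0"
      then have "v = (u \<bullet> v) *\<^sub>R u" by (simp add: orth_def)
      then have "norm v = \<bar>u \<bullet> v\<bar> * norm u" by (metis norm_scaleR)
      then show False using that by simp
    qed
    moreover have "u \<bullet> orth u v = 0" by (simp add: orth_def inner_diff_right \<open>u \<bullet> u = 1\<close>)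
    ultimately show ?thesis
      using that by (cases t) (auto simp: frames_def norm_sgn sgn_div_norm)
  qed
  have H_u: "H j (- u) v (- r, s, - z) = (if u_odd n j then - H j u v (r, s, z) else H j u v (r, s, z))"
    if "j < m" "norm u = 1" "norm v = 1" "(r, s, z) \<in> {-1..1} \<times> {-1..1} \<times> {-1..1}" for j u v r s z
  proof (cases "\<bar>u \<bullet> v\<bar> < 1")
    case True
    have "orth (- u) v = orth u v" by (simp add: orth_def)
    then show ?thesis
      using F_u[OF _ orth_frame[OF that(2,3) True that(4)], of j] that(1) n
      by (auto simp: H_def lam_def m_def u_odd_def algebra_simps)
  next
    case False
    then show ?thesis using n that(1) by (auto simp: H_def lam_def m_def u_odd_def)
  qed
  have H_v: "H j u (- v) (r, - s, - z) = (if v_odd n j then - H j u v (r, s, z) else H j u v (r, s, z))"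
    if "j < m" "norm u = 1" "norm v = 1" "(r, s, z) \<in> {-1..1} \<times> {-1..1} \<times> {-1..1}" for j u v r s z
  proof (cases "\<bar>u \<bullet> v\<bar> < 1")
    case True
    have "sgn (orth u (- v)) = - sgn (orth u v)" by (simp add: orth_def flip: sgn_minus)
    then show ?thesis
      using F_v[OF _ orth_frame[OF that(2,3) True that(4)], of j] that(1) n
      by (auto simp: H_def lam_def m_def v_odd_def algebra_simps)
  next
    case False
    then show ?thesis using n that(1) by (auto simp: H_def lam_def m_def v_odd_def)
  qed
  have cont_lam: "continuous_on unit_box (\<lambda>y. lam (U y) (V y) * F j (U y, sgn (orth (U y) (V y)), tl y))"
    if "j < m" for j
  proof -
    \<comment> \<open>The value \<open>3 / 4\<close> lies between the end of the cutoff and the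
      degenerate value 1: normalization is continuous on \<open>S1\<close>, the cutoff vanishes on
      \<open>S2\<close>, and both closed sets together cover the box.\<close>
    define S1 where "S1 = {y \<in> unit_box. \<bar>U y \<bullet> V y\<bar> \<le> 3 / 4}"
    define S2 where "S2 = {y \<in> unit_box. 1 / 2 \<le> \<bar>U y \<bullet> V y\<bar>}"
    have tl: "tl y \<in> {-1..1} \<times> {-1..1} \<times> {-1..1}" if "y \<in> unit_box" for y
      using that by (auto simp: tl_def unit_box_def)
    have clB: "closed unit_box"
      by (rule compact_imp_closed[OF compact_unit_box])
    have cont_UV: "continuous_on unit_box (\<lambda>y. \<bar>U y \<bullet> V y\<bar>)"
      by (intro continuous_intros cont_U cont_V)
    have sub: "S1 \<subseteq> unit_box" by (auto simp: S1_def)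
    note [continuous_intros] = continuous_on_subset[OF cont_U sub] continuous_on_subset[OF cont_V sub] cont_pr
    have fr: "(U y, sgn (orth (U y) (V y)), tl y) \<in> frames" if "y \<in> S1" for y
      using that tl by (intro orth_frame) (auto simp: S1_def U_def V_def norm_sph)
    have nz: "orth (U y) (V y) \<noteq> 0" if "y \<in> S1" for y
      using fr[OF that] by (auto simp: frames_def)
    have "continuous_on S1 (\<lambda>y. (U y, sgn (orth (U y) (V y)), tl y))"
      unfolding tl_def sgn_div_norm using nz
      by (auto intro!: continuous_intros simp: orth_def)
    then have "continuous_on S1 (\<lambda>y. F j (U y, sgn (orth (U y) (V y)), tl y))"
      by (rule continuous_on_compose2[OF cont[OF \<open>j < m\<close>[unfolded m_def]]]) (use fr in blast)
    then have 1: "continuous_on S1 (\<lambda>y. lam (U y) (V y) * F j (U y, sgn (orth (U y) (V y)), tl y))"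
      unfolding lam_def by (intro continuous_intros)
    have "lam (U y) (V y) = 0" if "y \<in> S2" for y using that by (auto simp: lam_def S2_def)
    then have 2: "continuous_on S2 (\<lambda>y. lam (U y) (V y) * F j (U y, sgn (orth (U y) (V y)), tl y))"
      by (subst continuous_on_cong[OF refl, of _ _ "\<lambda>_. 0"]) auto
    have "closed S1" "closed S2"
      using continuous_closed_preimage[OF cont_UV clB, of "{..3/4}"]
        continuous_closed_preimage[OF cont_UV clB, of "{1/2..}"]
      by (simp_all add: S1_def S2_def vimage_def Int_def)
    then have "continuous_on (S1 \<union> S2) (\<lambda>y. lam (U y) (V y) * F j (U y, sgn (orth (U y) (V y)), tl y))"
      using 1 2 by (rule continuous_on_closed_Un)
    moreover have "S1 \<union> S2 = unit_box" by (auto simp: S1_def S2_def)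
    ultimately show ?thesis by simp
  qed
  define f where "f j y = H j (U y) (V y) (tl y)" for j y
  \<comment> \<open>The choice depends only on the set \<open>{u, - u}\<close>, so it singles out
    one vector of each antipodal pair. It is not continuous, which the tie-breaking bits
    tolerate.\<close>
  define pos :: "'a \<Rightarrow> bool" where "pos u \<longleftrightarrow> u = (SOME w. w \<in> {u, - u})" for u
  have pos: "pos (- u) \<longleftrightarrow> \<not> pos u" if "norm u = 1" for u
  proof -
    have "{- u, - (- u)} = {u, - u}" by auto
    moreover have "(SOME w. w \<in> {u, - u}) \<in> {u, - u}" by (rule someI[of _ u]) simp
    moreover have "u \<noteq> - u"
    proof
      assume "u = - u"
      then have "u + u = 0" by (metis add.right_inverse)
      then have "u = 0" by (simp flip: scaleR_2)
      then show False using that by simp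
    qed
    ultimately show ?thesis unfolding pos_def by auto
  qed
  define e :: "nat \<Rightarrow> (nat \<Rightarrow> real) \<Rightarrow> bit"
    where "e j y = of_bool (u_odd n j \<and> pos (U y)) + of_bool (v_odd n j \<and> pos (V y))" for j y
  have glue_v: "U (glue \<theta> 1 m k y) = U y" "V (glue \<theta> 1 m k y) = - V y"
      "tl (glue \<theta> 1 m k y) = (case tl y of (r, s, z) \<Rightarrow> (r, - s, - z))"
    if "k < n" "y k = 0" for k y
  proof -
    have "glue \<theta> 1 m k y (n + l) = y (n + l)" if "l < n" for l
      using that \<open>k < n\<close> by (auto simp: glue_def \<theta>_iff v_odd_def)
    then show "U (glue \<theta> 1 m k y) = U y"
      unfolding U_def sph_def by (intro sum.cong refl arg_cong2[of _ _ _ _ scaleR] spherical_cong) auto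
    have "spherical n (glue \<theta> 1 m k y) i = - spherical n y i" if "i \<le> n" for i
      using \<open>k < n\<close> that \<open>y k = 0\<close>
      by (rule spherical_glue) (auto simp: glue_def \<theta>_iff v_odd_def m_def \<open>k < n\<close>)
    then show "V (glue \<theta> 1 m k y) = - V y"
      by (simp add: V_def sph_def sum_negf)
    show "tl (glue \<theta> 1 m k y) = (case tl y of (r, s, z) \<Rightarrow> (r, - s, - z))"
      using \<open>k < n\<close> by (auto simp: tl_def glue_def \<theta>_iff v_odd_def m_def)
  qed
  have glue_u: "U (glue \<theta> 1 m k y) = - U y" "V (glue \<theta> 1 m k y) = V y"
      "tl (glue \<theta> 1 m k y) = (case tl y of (r, s, z) \<Rightarrow> (- r, s, - z))"
    if "n \<le> k" "k < 2 * n" "y k = 0" for k y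
  proof -
    have "glue \<theta> 1 m k y l = y l" if "l < n" for l
      using that \<open>n \<le> k\<close> by (auto simp: glue_def)
    then show "V (glue \<theta> 1 m k y) = V y"
      unfolding V_def sph_def by (intro sum.cong refl arg_cong2[of _ _ _ _ scaleR] spherical_cong) auto
    have "spherical n (\<lambda>l. glue \<theta> 1 m k y (n + l)) i = - spherical n (\<lambda>l. y (n + l)) i" if "i \<le> n" for i
      by (rule spherical_glue[of "k - n"])
        (use that \<open>n \<le> k\<close> \<open>k < 2 * n\<close> \<open>y k = 0\<close> in \<open>auto simp: glue_def \<theta>_iff u_odd_def m_def\<close>)
    then show "U (glue \<theta> 1 m k y) = - U y"
      by (simp add: U_def sph_def sum_negf)
    show "tl (glue \<theta> 1 m k y) = (case tl y of (r, s, z) \<Rightarrow> (- r, s, - z))"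
      using \<open>n \<le> k\<close> \<open>k < 2 * n\<close> by (auto simp: tl_def glue_def \<theta>_iff u_odd_def m_def)
  qed
  have tl_mem: "tl y \<in> {-1..1} \<times> {-1..1} \<times> {-1..1}" if "y \<in> unit_box" for y
    using that by (auto simp: tl_def unit_box_def)
  have norms: "norm (U y) = 1" "norm (V y) = 1" for y by (auto simp: U_def V_def norm_sph)
  have "\<exists>y\<in>unit_box. \<forall>j<m. f j y = 0"
  proof (rule common_zero_on_glued_box[where G = "{..<2 * n}" and \<theta> = \<theta> and e = e])
    fix j assume j: "j < m"
    show "continuous_on unit_box (f j)"
    proof (cases "j = n - 1")
      case True
      then show ?thesis
        unfolding f_def H_def by (auto intro!: continuous_intros cont_U cont_V)
    next
      case False
      have ramp: "continuous_on unit_box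
          (\<lambda>y. case tl y of (r, s, z) \<Rightarrow> if j = 2 * n then r else if j = 2 * n + 1 then s else if j = 2 * n + 2 then z else 0)"
        by (cases "j = 2 * n"; cases "j = 2 * n + 1"; cases "j = 2 * n + 2")
          (auto simp: tl_def intro!: continuous_intros cont_pr)
      have "continuous_on unit_box (\<lambda>y. 1 - lam (U y) (V y))"
        unfolding lam_def by (intro continuous_intros cont_U cont_V)
      note continuous_on_mult[OF this ramp]
      then show ?thesis
        unfolding f_def H_def using False cont_lam[OF j] by (auto intro!: continuous_on_add)
    qed
  next
    fix k assume "k < m" "k \<in> {..<2 * n}"
    then show "\<theta> k k = 1" by (auto simp: \<theta>_iff u_odd_def v_odd_def)
  next
    fix j k y
    assume j: "j < m" and k: "k < m" "k \<in> {..<2 * n}" and y: "y \<in> unit_box" "y k = 0"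
    obtain r s z where t: "tl y = (r, s, z)" by (metis prod.exhaust)
    then have mem: "(r, s, z) \<in> {-1..1} \<times> {-1..1} \<times> {-1..1}" using tl_mem[OF y(1)] by metis
    show "f j (glue \<theta> 1 m k y) = (if \<theta> j k = 1 then - f j y else f j y)"
    proof (cases "k < n")
      case True
      then show ?thesis
        using H_v[OF j norms mem] y by (simp add: f_def glue_v t \<theta>_iff)
    next
      case False
      then show ?thesis
        using H_u[OF j norms mem] y k by (simp add: f_def glue_u t \<theta>_iff)
    qed
    show "e j (glue \<theta> 1 m k y) = e j y + \<theta> j k"
    proof (cases "k < n")
      case True
      then show ?thesis
        using y by (auto simp: e_def glue_v \<theta>_def pos norms)
    next
      case False
      then show ?thesis
        using y k by (auto simp: e_def glue_u \<theta>_def pos norms)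
    qed
  next
    fix k y
    assume k: "k < m" "k \<notin> {..<2 * n}" and y: "y \<in> unit_box"
    obtain r s z where t: "tl y = (r, s, z)" by (metis prod.exhaust)
    have mem: "tl y \<in> {-1..1} \<times> {-1..1} \<times> {-1..1}" using tl_mem[OF y] .
    have lam: "0 \<le> lam (U y) (V y)" "lam (U y) (V y) \<le> 1" "lam (U y) (V y) \<noteq> 0 \<Longrightarrow> \<bar>U y \<bullet> V y\<bar> < 1"
      by (auto simp: lam_def)
    have fr: "lam (U y) (V y) \<noteq> 0 \<Longrightarrow> (U y, sgn (orth (U y) (V y)), tl y) \<in> frames"
      using lam(3) by (intro orth_frame norms mem) auto
    have convex_neg: "a * x + (1 - a) * (-1) < 0" if "0 \<le> a" "a \<le> 1" "a \<noteq> 0 \<Longrightarrow> x < 0" for a x :: real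
    proof (cases "a = 0")
      case False
      then have "a * x < 0" using that by (simp add: mult_less_0_iff)
      moreover have "a * x + (1 - a) * (-1) = a * x + a - 1" by simp
      ultimately show ?thesis using that by linarith
    qed simp
    have convex_pos: "0 < a * x + (1 - a) * 1" if "0 \<le> a" "a \<le> 1" "a \<noteq> 0 \<Longrightarrow> 0 < x" for a x :: real
      using convex_neg[of a "- x"] that by auto
    have k': "k = 2 * n \<or> k = 2 * n + 1 \<or> k = 2 * n + 2" using k by (auto simp: m_def)
    show "f k y < 0" if "y k = 0"
    proof -
      have "lam (U y) (V y) * F k (U y, sgn (orth (U y) (V y)), tl y) + (1 - lam (U y) (V y)) * (-1) < 0"
        using lam(1,2)
      proof (rule convex_neg)
        assume "lam (U y) (V y) \<noteq> 0"
        from fr[OF this] show "F k (U y, sgn (orth (U y) (V y)), tl y) < 0"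
          using k' that r_low s_low z_low by (auto simp: tl_def)
      qed
      then show ?thesis using k' that n by (auto simp: f_def H_def tl_def)
    qed
    show "0 < f k y" if "y k = 1"
    proof -
      have "0 < lam (U y) (V y) * F k (U y, sgn (orth (U y) (V y)), tl y) + (1 - lam (U y) (V y)) * 1"
        using lam(1,2)
      proof (rule convex_pos)
        assume "lam (U y) (V y) \<noteq> 0"
        from fr[OF this] show "0 < F k (U y, sgn (orth (U y) (V y)), tl y)"
          using k' that r_high s_high z_high by (auto simp: tl_def)
      qed
      then show ?thesis using k' that n by (auto simp: f_def H_def tl_def)
    qed
  qed
  then obtain y where y: "y \<in> unit_box" and 0: "\<And>j. j < m \<Longrightarrow> f j y = 0" by blast
  \<comment> \<open>Equation \<open>n - 1\<close> yields orthogonality, where the cutoff equals 1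
    and every other \<open>H j\<close> is the given function.\<close>
  have orthogonal: "U y \<bullet> V y = 0" using 0[of "n - 1"] n by (simp add: m_def f_def H_def)
  have "(U y, sgn (orth (U y) (V y)), tl y) \<in> frames"
    using orthogonal by (intro orth_frame norms tl_mem y) auto
  moreover have "F j (U y, sgn (orth (U y) (V y)), tl y) = 0" if "j < 2 * n + 3" "j \<noteq> n - 1" for j
    using 0[of j] that orthogonal by (simp add: m_def f_def H_def lam_def)
  ultimately show ?thesis by blast
qed

section \<open>Half-space masses and centre points\<close>

definition half :: "'a::euclidean_space measure \<Rightarrow> 'a \<Rightarrow> real \<Rightarrow> real" where
  "half M a r = measure M {x. a \<bullet> x \<le> r}"

definition quarter :: "'a::euclidean_space measure \<Rightarrow> 'a \<Rightarrow> real \<Rightarrow> 'a \<Rightarrow> real \<Rightarrow> real" where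
  "quarter M a r b s = measure M {x. a \<bullet> x \<le> r \<and> b \<bullet> x \<le> s}"

locale ac_prob_space = prob_space M for M :: "'a::euclidean_space measure" +
  assumes sets_M: "sets M = sets borel" and ac: "absolutely_continuous lborel M"
begin

lemma space_M: "space M = UNIV"
  using sets_eq_imp_space_eq[OF sets_M] by simp

lemma closed_in_sets: "closed S \<Longrightarrow> S \<in> sets M"
  by (simp add: sets_M borel_closed)

lemma closed_quarter: "closed {x. a \<bullet> x \<le> r \<and> b \<bullet> x \<le> s}"
  using closed_Int[OF closed_halfspace_le[of a r] closed_halfspace_le[of b s]] by (simp add: Int_def)

lemma hyperplane_null: "a \<noteq> 0 \<Longrightarrow> {x. a \<bullet> x = r} \<in> null_sets M"
proof -
  assume "a \<noteq> 0"
  then have "{x. a \<bullet> x = r} \<in> null_sets (completion lborel)"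
    using negligible_hyperplane[of a r] by (simp add: negligible_iff_null_sets)
  moreover have "{x. a \<bullet> x = r} \<in> sets lborel" by (simp add: borel_closed closed_hyperplane)
  ultimately have "{x. a \<bullet> x = r} \<in> null_sets lborel"
    by (simp add: null_sets_completion_iff)
  then show ?thesis using ac by (auto simp: absolutely_continuous_def)
qed

lemma AE_off_hyperplane: "a \<noteq> 0 \<Longrightarrow> AE x in M. a \<bullet> x \<noteq> r"
  using AE_not_in[OF hyperplane_null[of a r]] by simp

lemma half_eq_quarter: "half M a r = quarter M a r a r"
  by (simp add: half_def quarter_def)

lemma quarter_commute: "quarter M a r b s = quarter M b s a r"
  by (simp add: quarter_def conj_commute)

lemma half_bounds: "0 \<le> half M a r" "half M a r \<le> 1"
  by (auto simp: half_def)

text \<open>The flipped half-space is the complement up to its boundary hyperplane, a null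
  set.\<close>

lemma quarter_minus: "a \<noteq> 0 \<Longrightarrow> quarter M (- a) (- r) b s = half M b s - quarter M a r b s"
proof -
  assume a: "a \<noteq> 0"
  let ?P = "{x. - a \<bullet> x \<le> - r \<and> b \<bullet> x \<le> s}" and ?Q = "{x. a \<bullet> x \<le> r \<and> b \<bullet> x \<le> s}"
  have "AE x in M. (x \<in> ?P) = (x \<in> {x. b \<bullet> x \<le> s} - ?Q)"
    using AE_off_hyperplane[OF a, of r] by eventually_elim auto
  moreover have sets: "?P \<in> sets M" "{x. b \<bullet> x \<le> s} \<in> sets M" "?Q \<in> sets M"
    by (rule closed_in_sets, rule closed_quarter closed_halfspace_le)+
  ultimately have "measure M ?P = measure M ({x. b \<bullet> x \<le> s} - ?Q)"
    by (intro finite_measure_eq_AE sets.Diff)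
  also have "\<dots> = measure M {x. b \<bullet> x \<le> s} - measure M ?Q"
    using sets(2,3) by (rule finite_measure_Diff) auto
  finally show ?thesis by (simp add: quarter_def half_def)
qed

lemma quarter_minus': "b \<noteq> 0 \<Longrightarrow> quarter M a r (- b) (- s) = half M a r - quarter M a r b s"
  using quarter_minus[of b s a r] by (simp add: quarter_commute[of a r])

lemma half_minus: "a \<noteq> 0 \<Longrightarrow> half M (- a) (- r) = 1 - half M a r"
  \<comment> \<open>Normal 0 with offset 0 describes the whole space.\<close>
  using quarter_minus[of a r 0 0] prob_space by (simp add: quarter_def half_def space_M)

lemma quarter_same: "quarter M a r a s = min (half M a r) (half M a s)"
proof -
  have mono: "half M a r \<le> half M a s" if "r \<le> s" for r s
    unfolding half_def using that
    by (intro finite_measure_mono closed_in_sets closed_halfspace_le) auto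
  have "quarter M a r a s = half M a (min r s)" by (simp add: quarter_def half_def)
  then show ?thesis using mono[of r s] mono[of s r] by (auto simp: min_def)
qed

text \<open>Off the two boundary hyperplanes each inequality holds or fails strictly, hence is
  stable under small changes of the parameters. The hyperplanes are null, so dominated convergence
  applies.\<close>

lemma continuous_on_quarter:
  fixes a b :: "'c::metric_space \<Rightarrow> 'a" and r s :: "'c \<Rightarrow> real"
  assumes cont: "continuous_on S a" "continuous_on S r" "continuous_on S b" "continuous_on S s"
    and nz: "\<And>y. y \<in> S \<Longrightarrow> a y \<noteq> 0" "\<And>y. y \<in> S \<Longrightarrow> b y \<noteq> 0"
  shows "continuous_on S (\<lambda>y. quarter M (a y) (r y) (b y) (s y))"
  unfolding continuous_on_sequentially comp_def
proof (intro allI ballI impI, elim conjE)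
  fix f :: "nat \<Rightarrow> 'c" and y
  assume y: "y \<in> S" and f: "\<forall>n. f n \<in> S" "f \<longlonglongrightarrow> y"
  let ?P = "\<lambda>y x. a y \<bullet> x \<le> r y \<and> b y \<bullet> x \<le> s y"
  have lim: "(\<lambda>n. g (f n)) \<longlonglongrightarrow> g y" if "continuous_on S g" for g :: "'c \<Rightarrow> 'd::topological_space"
    using continuous_on_tendsto_compose[OF that f(2) y] f(1) by simp
  have ev: "\<forall>\<^sub>F n in sequentially. (c n \<le> k n) = (c' \<le> k')"
    if "c \<longlonglongrightarrow> c'" "k \<longlonglongrightarrow> k'" "c' \<noteq> k'" for c k :: "nat \<Rightarrow> real" and c' k'
  proof (cases "c' < k'")
    case True
    then show ?thesis using order_tendstoD(1)[OF tendsto_diff[OF that(2,1)], of 0]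
      by (auto elim: eventually_mono)
  next
    case False
    then have "k' < c'" using that by simp
    then show ?thesis using order_tendstoD(1)[OF tendsto_diff[OF that(1,2)], of 0]
      by (auto elim!: eventually_mono)
  qed
  have "(\<lambda>n. \<integral>x. indicator {x. ?P (f n) x} x \<partial>M) \<longlonglongrightarrow> (\<integral>x. indicator {x. ?P y x} x \<partial>M :: real)"
  proof (rule integral_dominated_convergence[where w = "\<lambda>_. 1"])
    show "AE x in M. (\<lambda>n. indicator {x. ?P (f n) x} x) \<longlonglongrightarrow> (indicator {x. ?P y x} x :: real)"
      using AE_off_hyperplane[OF nz(1)[OF y], of "r y"] AE_off_hyperplane[OF nz(2)[OF y], of "s y"]
    proof eventually_elim
      case (elim x)
      have "\<forall>\<^sub>F n in sequentially. (a (f n) \<bullet> x \<le> r (f n)) = (a y \<bullet> x \<le> r y)"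
        "\<forall>\<^sub>F n in sequentially. (b (f n) \<bullet> x \<le> s (f n)) = (b y \<bullet> x \<le> s y)"
        using elim by (intro ev lim[OF cont(2)] lim[OF cont(4)] tendsto_inner lim[OF cont(1)] lim[OF cont(3)] tendsto_const; simp)+
      then have "\<forall>\<^sub>F n in sequentially. indicator {x. ?P (f n) x} x = (indicator {x. ?P y x} x :: real)"
        by eventually_elim (simp add: indicator_def)
      then show ?case by (rule tendsto_eventually)
    qed
  qed (auto simp: closed_in_sets closed_quarter intro!: borel_measurable_indicator)
  then show "(\<lambda>n. quarter M (a (f n)) (r (f n)) (b (f n)) (s (f n))) \<longlonglongrightarrow> quarter M (a y) (r y) (b y) (s y)"
    by (simp add: quarter_def space_M)
qed

lemma continuous_on_half:
  fixes a :: "'c::metric_space \<Rightarrow> 'a" and r :: "'c \<Rightarrow> real"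
  assumes "continuous_on S a" "continuous_on S r" "\<And>y. y \<in> S \<Longrightarrow> a y \<noteq> 0"
  shows "continuous_on S (\<lambda>y. half M (a y) (r y))"
  unfolding half_eq_quarter using assms by (intro continuous_on_quarter)

lemma ex_radius: "\<exists>R>0. \<forall>a. norm a = 1 \<longrightarrow> half M a (- R) < 1 / 2 \<and> 1 / 2 < half M a R"
proof -
  have "(\<lambda>n. measure M (cball 0 (real n))) \<longlonglongrightarrow> measure M (\<Union>n. cball 0 (real n))"
    by (rule finite_Lim_measure_incseq) (auto simp: closed_in_sets incseq_def)
  moreover have "(\<Union>n. cball 0 (real n)) = space M"
    unfolding space_M by (auto simp: real_arch_simple)
  ultimately have "(\<lambda>n. measure M (cball 0 (real n))) \<longlonglongrightarrow> 1" by (simp add: prob_space)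
  then have "\<forall>\<^sub>F n in sequentially. 1 / 2 < measure M (cball 0 (real n))"
    by (rule order_tendstoD) simp
  then obtain n :: nat where n: "1 / 2 < measure M (cball 0 (real n))"
    by (auto simp: eventually_sequentially)
  let ?R = "real n + 1"
  have "half M a (- ?R) < 1 / 2 \<and> 1 / 2 < half M a ?R" if "norm a = 1" for a
  proof -
    have bound: "\<bar>a \<bullet> x\<bar> \<le> norm x" for x
      using Cauchy_Schwarz_ineq2[of a x] that by simp
    have "half M a (- ?R) \<le> measure M (space M - cball 0 (real n))"
      unfolding half_def
    proof (rule finite_measure_mono)
      show "{x. a \<bullet> x \<le> - ?R} \<subseteq> space M - cball 0 (real n)"
      proof
        fix x assume "x \<in> {x. a \<bullet> x \<le> - ?R}"
        then show "x \<in> space M - cball 0 (real n)" using bound[of x] by (simp add: space_M)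
      qed
    qed (intro sets.Diff sets.top closed_in_sets closed_cball)
    also have "\<dots> = 1 - measure M (cball 0 (real n))"
      by (intro prob_compl closed_in_sets) simp
    finally have "half M a (- ?R) < 1 / 2" using n by simp
    moreover have "measure M (cball 0 (real n)) \<le> half M a ?R"
      unfolding half_def
    proof (rule finite_measure_mono)
      show "cball 0 (real n) \<subseteq> {x. a \<bullet> x \<le> ?R}"
      proof
        fix x :: 'a assume "x \<in> cball 0 (real n)"
        then show "x \<in> {x. a \<bullet> x \<le> ?R}" using bound[of x] by simp
      qed
    qed (auto intro!: closed_in_sets closed_halfspace_le)
    ultimately show ?thesis using n by simp
  qed
  then show ?thesis by (intro exI[of _ ?R]) auto
qed

end

section \<open>Centre points from the vanishing of a vector integral\<close>

definition deficit :: "'a::euclidean_space measure \<Rightarrow> 'a \<Rightarrow> 'a \<Rightarrow> 'a \<Rightarrow> real \<Rightarrow> real \<Rightarrow> real" where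
  "deficit M p u v x y = max 0 (1 / 3 - half M (x *\<^sub>R u + y *\<^sub>R v) ((x *\<^sub>R u + y *\<^sub>R v) \<bullet> p))"

text \<open>Coordinates of the integral of the deficit times the direction over the unit circle of the
  plane spanned by \<open>u\<close> and \<open>v\<close>, with the four quadrants folded together.\<close>

definition pull_u :: "'a::euclidean_space measure \<Rightarrow> 'a \<Rightarrow> 'a \<Rightarrow> 'a \<Rightarrow> real" where
  "pull_u M p u v = integral {0..pi / 2} (\<lambda>t. (deficit M p u v (cos t) (sin t) + deficit M p u v (cos t) (- sin t)
     - deficit M p u v (- cos t) (sin t) - deficit M p u v (- cos t) (- sin t)) * cos t)"

definition pull_v :: "'a::euclidean_space measure \<Rightarrow> 'a \<Rightarrow> 'a \<Rightarrow> 'a \<Rightarrow> real" where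
  "pull_v M p u v = integral {0..pi / 2} (\<lambda>t. (deficit M p u v (cos t) (sin t) - deficit M p u v (cos t) (- sin t)
     + deficit M p u v (- cos t) (sin t) - deficit M p u v (- cos t) (- sin t)) * sin t)"

lemma deficit_minus: "deficit M p (- u) v x y = deficit M p u v (- x) y" "deficit M p u (- v) x y = deficit M p u v x (- y)"
  by (simp_all add: deficit_def)

text \<open>After folding the quadrants, a sign change of \<open>u\<close> or \<open>v\<close>
  merely permutes the four terms under the integral.\<close>

lemma pull_minus:
  "pull_u M p (- u) v = - pull_u M p u v" "pull_u M p u (- v) = pull_u M p u v"
  "pull_v M p (- u) v = pull_v M p u v" "pull_v M p u (- v) = - pull_v M p u v"
  by (simp_all add: pull_u_def pull_v_def deficit_minus algebra_simps flip: integral_neg)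

lemma orthonormal_combination_nonzero:
  assumes "norm u = 1" "norm v = 1" "u \<bullet> v = 0" "x\<^sup>2 + y\<^sup>2 = 1"
  shows "norm (x *\<^sub>R u + y *\<^sub>R v) = 1" "x *\<^sub>R u + y *\<^sub>R v \<noteq> (0 :: 'a::real_inner)"
proof -
  have "u \<bullet> u = 1" "v \<bullet> v = 1" using assms by (simp_all add: norm_eq_1)
  then have "(x *\<^sub>R u + y *\<^sub>R v) \<bullet> (x *\<^sub>R u + y *\<^sub>R v) = x\<^sup>2 + y\<^sup>2"
    using assms(3) by (simp add: inner_add_left inner_add_right inner_commute power2_eq_square)
  then show "norm (x *\<^sub>R u + y *\<^sub>R v) = 1" by (simp add: norm_eq_1 assms(4))
  then show "x *\<^sub>R u + y *\<^sub>R v \<noteq> 0" by auto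
qed

context ac_prob_space
begin

lemma deficit_bounds: "0 \<le> deficit M p u v x y" "deficit M p u v x y \<le> 1 / 3"
proof -
  show "0 \<le> deficit M p u v x y" by (simp add: deficit_def)
  show "deficit M p u v x y \<le> 1 / 3"
    unfolding deficit_def by (rule max.boundedI) (simp_all add: half_bounds)
qed

lemma continuous_on_deficit:
  fixes p u v :: "'c::metric_space \<Rightarrow> 'a" and x y :: "'c \<Rightarrow> real"
  assumes "continuous_on S p" "continuous_on S u" "continuous_on S v" "continuous_on S x" "continuous_on S y"
    and "\<And>c. c \<in> S \<Longrightarrow> norm (u c) = 1 \<and> norm (v c) = 1 \<and> u c \<bullet> v c = 0 \<and> (x c)\<^sup>2 + (y c)\<^sup>2 = 1"
  shows "continuous_on S (\<lambda>c. deficit M (p c) (u c) (v c) (x c) (y c))"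
  unfolding deficit_def using assms orthonormal_combination_nonzero(2)
  by (intro continuous_intros continuous_on_half) blast+

text \<open>Three closed half-spaces with boundaries through \<open>p\<close> whose normals positively span the plane
  cover the space, so they cannot all have measure below one third.\<close>

lemma deficit_directions_in_halfplane:
  "0 \<notin> convex hull {w. 0 < deficit M p u v (Re w) (Im w)}"
proof
  define n where "n w = Re w *\<^sub>R u + Im w *\<^sub>R v" for w
  let ?\<Theta> = "{w. 0 < deficit M p u v (Re w) (Im w)}"
  assume "0 \<in> convex hull ?\<Theta>"
  \<comment> \<open>Caratheodory in the plane: three directions suffice, which is where the
    threshold \<open>1 / 3\<close> comes from.\<close>
  then obtain S where S: "finite S" "S \<subseteq> ?\<Theta>" "card S \<le> 3" and "0 \<in> convex hull S"
    unfolding caratheodory[of ?\<Theta>] by auto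
  then obtain c where c: "\<And>w. w \<in> S \<Longrightarrow> 0 \<le> c w" "sum c S = 1" "(\<Sum>w\<in>S. c w *\<^sub>R w) = 0"
    by (auto simp: convex_hull_finite)
  have S_ne: "S \<noteq> {}" using c(2) by auto
  let ?H = "\<lambda>w. {x. n w \<bullet> x \<le> n w \<bullet> p}"
  have "\<exists>w\<in>S. x \<in> ?H w" for x
  proof (rule ccontr)
    assume "\<not> ?thesis"
    then have neg: "0 < n w \<bullet> (x - p)" if "w \<in> S" for w
      using that by (force simp: inner_diff_right)
    have "(\<Sum>w\<in>S. c w * Re w) = 0" "(\<Sum>w\<in>S. c w * Im w) = 0"
      using arg_cong[OF c(3), of Re] arg_cong[OF c(3), of Im] by simp_all
    moreover have "(\<Sum>w\<in>S. c w * (n w \<bullet> (x - p)))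
        = (\<Sum>w\<in>S. c w * Re w) * (u \<bullet> (x - p)) + (\<Sum>w\<in>S. c w * Im w) * (v \<bullet> (x - p))"
      unfolding sum_distrib_right sum.distrib[symmetric]
      by (intro sum.cong) (auto simp: n_def inner_add_left algebra_simps)
    ultimately have "(\<Sum>w\<in>S. c w * (n w \<bullet> (x - p))) = 0" by simp
    then have "\<forall>w\<in>S. c w * (n w \<bullet> (x - p)) = 0"
      using S(1) c(1) neg sum_nonneg_eq_0_iff[of S "\<lambda>w. c w * (n w \<bullet> (x - p))"] by (simp add: less_imp_le)
    then have "\<forall>w\<in>S. c w = 0" using neg by fastforce
    then show False using c(2) by simp
  qed
  then have "space M = (\<Union>w\<in>S. ?H w)" by (auto simp: space_M)
  then have "1 = measure M (\<Union>w\<in>S. ?H w)" using prob_space by simp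
  also have "\<dots> \<le> (\<Sum>w\<in>S. measure M (?H w))"
    using S(1) by (intro finite_measure_subadditive_finite)
      (auto intro!: closed_in_sets closed_halfspace_le)
  also have "\<dots> < (\<Sum>w\<in>S. 1 / 3)"
    using S S_ne by (intro sum_strict_mono) (auto simp: deficit_def n_def half_def)
  also have "\<dots> \<le> 1" using S(3) by simp
  finally show False by simp
qed

text \<open>Some nonzero functional \<open>l\<close> is nonnegative on all directions of positive
  deficit. Applied to the pull it gives the integral of a nonnegative continuous function, so
  vanishing pull forces \<open>l\<close> to vanish on these directions. By continuity they would
  contain an arc, on which only the zero functional vanishes.\<close>

lemma no_deficit_if_no_pull:
  assumes uv: "norm u = 1" "norm v = 1" "u \<bullet> v = 0"
    and pull: "pull_u M p u v = 0" "pull_v M p u v = 0"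
    and xy: "x\<^sup>2 + y\<^sup>2 = 1"
  shows "deficit M p u v x y = 0"
proof (rule ccontr)
  assume "deficit M p u v x y \<noteq> 0"
  then have pos: "0 < deficit M p u v x y" using deficit_bounds(1)[of p u v x y] by linarith
  let ?\<Theta> = "{w. 0 < deficit M p u v (Re w) (Im w)}"
  obtain l where l: "l \<noteq> 0" "\<And>w. w \<in> convex hull ?\<Theta> \<Longrightarrow> 0 \<le> l \<bullet> w"
    using separating_hyperplane_set_0[OF convex_convex_hull deficit_directions_in_halfplane, of p u v] by blast
  define g where "g \<epsilon> \<eta> t = deficit M p u v (\<epsilon> * cos t) (\<eta> * sin t) * (Re l * (\<epsilon> * cos t) + Im l * (\<eta> * sin t))"
    for \<epsilon> \<eta> t
  have D_cont: "continuous_on {0..pi / 2} (\<lambda>t. deficit M p u v (\<epsilon> * cos t) (\<eta> * sin t))"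
    if "\<epsilon>\<^sup>2 = 1" "\<eta>\<^sup>2 = 1" for \<epsilon> \<eta>
    by (intro continuous_on_deficit continuous_intros) (use uv that in \<open>auto simp: power_mult_distrib\<close>)
  have sgn: "\<epsilon>\<^sup>2 = 1 \<longleftrightarrow> \<epsilon> = 1 \<or> \<epsilon> = -1" for \<epsilon> :: real by (rule power2_eq_1_iff)
  have g_cont: "continuous_on {0..pi / 2} (g \<epsilon> \<eta>)" if "\<epsilon>\<^sup>2 = 1" "\<eta>\<^sup>2 = 1" for \<epsilon> \<eta>
    unfolding g_def by (intro continuous_intros D_cont that)
  have g_nonneg: "0 \<le> g \<epsilon> \<eta> t" for \<epsilon> \<eta> t
  proof (cases "deficit M p u v (\<epsilon> * cos t) (\<eta> * sin t) = 0")
    case False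
    then have "0 < deficit M p u v (\<epsilon> * cos t) (\<eta> * sin t)"
      using deficit_bounds(1)[of p u v "\<epsilon> * cos t" "\<eta> * sin t"] by linarith
    then have "Complex (\<epsilon> * cos t) (\<eta> * sin t) \<in> ?\<Theta>" by simp
    then show ?thesis
      using l(2)[OF hull_inc, of "Complex (\<epsilon> * cos t) (\<eta> * sin t)"] deficit_bounds(1)
      by (auto simp: g_def inner_complex_def intro!: mult_nonneg_nonneg)
  qed (simp add: g_def)
  let ?D = "\<lambda>\<epsilon> \<eta> t. deficit M p u v (\<epsilon> * cos t) (\<eta> * sin t)"
  let ?G = "\<lambda>t. g 1 1 t + g 1 (-1) t + g (-1) 1 t + g (-1) (-1) t"
  have "integral {0..pi / 2} ?G = integral {0..pi / 2} (\<lambda>t.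
      Re l * ((?D 1 1 t + ?D 1 (-1) t - ?D (-1) 1 t - ?D (-1) (-1) t) * cos t) +
      Im l * ((?D 1 1 t - ?D 1 (-1) t + ?D (-1) 1 t - ?D (-1) (-1) t) * sin t))"
    by (rule arg_cong[of _ _ "integral _"]) (auto simp: g_def algebra_simps)
  also have "\<dots> = Re l * pull_u M p u v + Im l * pull_v M p u v"
    unfolding pull_u_def pull_v_def
    by (subst integral_add) (auto intro!: integrable_continuous_real continuous_intros D_cont
        simp: D_cont[of 1 1, simplified] D_cont[of 1 "-1", simplified] D_cont[of "-1" 1, simplified] D_cont[of "-1" "-1", simplified])
  finally have "integral {0..pi / 2} ?G = 0" using pull by simp
  moreover have "continuous_on {0..pi / 2} ?G" by (intro continuous_intros g_cont) auto
  moreover have "0 \<le> ?G t" for t using g_nonneg by (intro add_nonneg_nonneg)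
  ultimately have "\<forall>t\<in>{0..pi / 2}. ?G t = 0"
    using integral_eq_0_iff[of 0 "pi / 2" ?G] by simp
  then have g_0: "g \<epsilon> \<eta> t = 0" if "t \<in> {0..pi / 2}" "\<epsilon>\<^sup>2 = 1" "\<eta>\<^sup>2 = 1" for \<epsilon> \<eta> t
    using that(1) g_nonneg[of 1 1 t] g_nonneg[of 1 "-1" t] g_nonneg[of "-1" 1 t] g_nonneg[of "-1" "-1" t] that(2,3)
    unfolding sgn by (auto dest!: bspec[of _ _ t])
  obtain t where t: "t \<in> {0..pi / 2}" "\<bar>x\<bar> = cos t" "\<bar>y\<bar> = sin t"
  proof -
    have "\<bar>x\<bar> \<le> 1" using xy by (metis abs_square_le_1 le_add_same_cancel1 zero_le_power2)
    have "sin (arccos \<bar>x\<bar>) = sqrt (1 - x\<^sup>2)" using \<open>\<bar>x\<bar> \<le> 1\<close> by (simp add: sin_arccos)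
    also have "1 - x\<^sup>2 = y\<^sup>2" using xy by simp
    finally have "sin (arccos \<bar>x\<bar>) = \<bar>y\<bar>" by simp
    moreover have "arccos \<bar>x\<bar> \<le> pi / 2" "0 \<le> arccos \<bar>x\<bar>"
      using \<open>\<bar>x\<bar> \<le> 1\<close> by (rule arccos_le_pi2[OF abs_ge_zero], intro arccos_lbound) auto
    ultimately show ?thesis
      using that[of "arccos \<bar>x\<bar>"] \<open>\<bar>x\<bar> \<le> 1\<close> by simp
  qed
  obtain \<epsilon> \<eta> :: real where e: "\<epsilon>\<^sup>2 = 1" "\<eta>\<^sup>2 = 1" "x = \<epsilon> * cos t" "y = \<eta> * sin t"
  proof -
    have "(if x < 0 then -1 else 1 :: real)\<^sup>2 = 1" "(if y < 0 then -1 else 1 :: real)\<^sup>2 = 1" by auto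
    moreover have "x = (if x < 0 then -1 else 1) * cos t" "y = (if y < 0 then -1 else 1) * sin t"
      using t by auto
    ultimately show ?thesis by (rule that)
  qed
  have D_pos: "0 < ?D \<epsilon> \<eta> t" using pos e by simp
  obtain d where d: "0 < d" "\<And>t'. t' \<in> {0..pi / 2} \<Longrightarrow> \<bar>t' - t\<bar> < d \<Longrightarrow> 0 < ?D \<epsilon> \<eta> t'"
  proof -
    obtain d where "0 < d" "\<forall>t'\<in>{0..pi / 2}. dist t' t < d \<longrightarrow> dist (?D \<epsilon> \<eta> t') (?D \<epsilon> \<eta> t) < ?D \<epsilon> \<eta> t"
      using D_cont[OF e(1,2)] t(1) D_pos unfolding continuous_on_iff by blast
    then show ?thesis
      by (intro that[of d]) (auto simp: dist_real_def abs_less_iff)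
  qed
  \<comment> \<open>The bound \<open>pi / 4\<close> keeps a step towards the middle of the quadrant
    inside the quadrant and makes \<open>sin \<delta>\<close> positive.\<close>
  define \<delta> where "\<delta> = min (d / 2) (pi / 4)"
  have \<delta>: "0 < \<delta>" "\<delta> < d" "\<delta> \<le> pi / 4" using d(1) by (auto simp: \<delta>_def)
  define t' where "t' = (if t \<le> pi / 4 then t + \<delta> else t - \<delta>)"
  have t': "t' \<in> {0..pi / 2}" "\<bar>t' - t\<bar> < d" using t(1) \<delta> by (auto simp: t'_def)
  have sin: "sin (t' - t) \<noteq> 0"
  proof -
    have "0 < sin \<delta>" using \<delta> by (intro sin_gt_zero) auto
    then show ?thesis by (auto simp: t'_def)
  qed
  have 1: "Re l * (\<epsilon> * cos t) + Im l * (\<eta> * sin t) = 0"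
    using g_0[OF t(1) e(1,2)] D_pos by (auto simp: g_def)
  have 2: "Re l * (\<epsilon> * cos t') + Im l * (\<eta> * sin t') = 0"
    using g_0[OF t'(1) e(1,2)] d(2)[OF t'] by (auto simp: g_def)
  \<comment> \<open>Two linear equations in \<open>Re l * \<epsilon>\<close> and
    \<open>Im l * \<eta>\<close> with determinant \<open>sin (t' - t)\<close>.\<close>
  have "(Re l * \<epsilon>) * sin (t' - t) = 0" "(Im l * \<eta>) * sin (t' - t) = 0"
    using 1 2 unfolding sin_diff by algebra+
  then have "Re l = 0" "Im l = 0" using sin e(1,2) by auto
  then show False using l(1) by (simp add: complex_eq_iff)
qed

end

text \<open>Made for hyperplanes that become parallel: the crossing point may escape to infinity and
  the pull need not converge, but it stays bounded, so a factor tending to zero restores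
  continuity.\<close>

lemma continuous_on_mult_vanishing:
  fixes c f :: "'a::metric_space \<Rightarrow> real"
  assumes c: "continuous_on S c" and f: "continuous_on {x \<in> S. c x \<noteq> 0} f"
    and bound: "\<And>x. x \<in> S \<Longrightarrow> c x \<noteq> 0 \<Longrightarrow> \<bar>f x\<bar> \<le> C"
  shows "continuous_on S (\<lambda>x. c x * f x)"
  unfolding continuous_on_def
proof
  fix x assume x: "x \<in> S"
  have cx: "(c \<longlongrightarrow> c x) (at x within S)" using c x by (simp add: continuous_on_def)
  show "((\<lambda>x. c x * f x) \<longlongrightarrow> c x * f x) (at x within S)"
  proof (cases "c x = 0")
    case True
    have "((\<lambda>y. c y * f y) \<longlongrightarrow> 0) (at x within S)"
    proof (rule Lim_null_comparison)
      show "\<forall>\<^sub>F y in at x within S. norm (c y * f y) \<le> \<bar>c y\<bar> * \<bar>C\<bar>"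
        unfolding eventually_at_filter
      proof (intro always_eventually allI impI)
        fix y assume "y \<in> S"
        then show "norm (c y * f y) \<le> \<bar>c y\<bar> * \<bar>C\<bar>"
          using bound[of y] by (cases "c y = 0") (auto simp: abs_mult intro!: mult_left_mono)
      qed
      show "((\<lambda>y. \<bar>c y\<bar> * \<bar>C\<bar>) \<longlongrightarrow> 0) (at x within S)"
        using tendsto_mult_left_zero[OF tendsto_rabs_zero[OF cx[unfolded True]]] by simp
    qed
    then show ?thesis using True by simp
  next
    case False
    have "(f \<longlongrightarrow> f x) (at x within {x \<in> S. c x \<noteq> 0})"
      using f x False by (simp add: continuous_on_def)
    moreover have "\<forall>\<^sub>F y in at x within S. c y \<noteq> 0"
      using cx False by (rule tendsto_imp_eventually_ne)
    then have "\<forall>\<^sub>F y in at x. (y \<in> {x \<in> S. c x \<noteq> 0}) = (y \<in> S)"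
      unfolding eventually_at_filter by (auto elim!: eventually_mono)
    ultimately have "(f \<longlongrightarrow> f x) (at x within S)"
      by (rule Lim_transform_within_set)
    then show ?thesis using cx by (intro tendsto_mult)
  qed
qed

context ac_prob_space
begin

lemma continuous_on_pull:
  fixes p u v :: "'c::metric_space \<Rightarrow> 'a"
  assumes cont: "continuous_on S p" "continuous_on S u" "continuous_on S v"
    and uv: "\<And>c. c \<in> S \<Longrightarrow> norm (u c) = 1 \<and> norm (v c) = 1 \<and> u c \<bullet> v c = 0"
  shows "continuous_on S (\<lambda>c. pull_u M (p c) (u c) (v c))" "continuous_on S (\<lambda>c. pull_v M (p c) (u c) (v c))"
proof -
  have fst: "continuous_on (S \<times> cbox 0 (pi / 2)) (\<lambda>c. g (fst c))" if "continuous_on S g" for g :: "'c \<Rightarrow> 'd::topological_space"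
    by (rule continuous_on_compose2[OF that continuous_on_fst]) (auto intro: continuous_on_id)
  have D: "continuous_on (S \<times> cbox 0 (pi / 2)) (\<lambda>c. deficit M (p (fst c)) (u (fst c)) (v (fst c)) (x (snd c)) (y (snd c)))"
    if "continuous_on UNIV x" "continuous_on UNIV y" "\<And>t. (x t)\<^sup>2 + (y t)\<^sup>2 = 1" for x y
    using uv that by (intro continuous_on_deficit fst cont)
      (auto intro!: continuous_on_compose2[OF that(1) continuous_on_snd] continuous_on_compose2[OF that(2) continuous_on_snd] continuous_on_id)
  have sc: "continuous_on T sin" "continuous_on T cos" for T :: "real set"
    by (intro continuous_intros)+
  show "continuous_on S (\<lambda>c. pull_u M (p c) (u c) (v c))"
    unfolding pull_u_def cbox_interval[symmetric]
    by (rule integral_continuous_on_param, unfold case_prod_unfold,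
        intro continuous_on_mult continuous_on_add continuous_on_diff D continuous_on_compose2[OF sc(2) continuous_on_snd])
      (auto intro!: continuous_intros)
  show "continuous_on S (\<lambda>c. pull_v M (p c) (u c) (v c))"
    unfolding pull_v_def cbox_interval[symmetric]
    by (rule integral_continuous_on_param, unfold case_prod_unfold,
        intro continuous_on_mult continuous_on_add continuous_on_diff D continuous_on_compose2[OF sc(1) continuous_on_snd])
      (auto intro!: continuous_intros)
qed

lemma pull_bounded:
  assumes uv: "norm u = 1" "norm v = 1" "u \<bullet> v = 0"
  shows "\<bar>pull_u M p u v\<bar> \<le> pi" "\<bar>pull_v M p u v\<bar> \<le> pi"
proof -
  have D: "continuous_on {0..pi / 2} (\<lambda>t. deficit M p u v (x t) (y t))"
    if "continuous_on {0..pi / 2} x" "continuous_on {0..pi / 2} y" "\<And>t. (x t)\<^sup>2 + (y t)\<^sup>2 = 1" for x y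
    using uv that by (intro continuous_on_deficit continuous_on_const) auto
  have bound: "norm ((a + b - c - d) * k) \<le> 2"
    if "0 \<le> a" "a \<le> 1 / 3" "0 \<le> b" "b \<le> 1 / 3" "0 \<le> c" "c \<le> 1 / 3" "0 \<le> d" "d \<le> 1 / 3" "\<bar>k\<bar> \<le> 1"
    for a b c d k :: real
  proof -
    have "\<bar>a + b - c - d\<bar> * \<bar>k\<bar> \<le> 2 * 1" using that by (intro mult_mono) auto
    then show ?thesis by (simp add: abs_mult)
  qed
  have bound': "norm ((a - b + c - d) * k) \<le> 2"
    if "0 \<le> a" "a \<le> 1 / 3" "0 \<le> b" "b \<le> 1 / 3" "0 \<le> c" "c \<le> 1 / 3" "0 \<le> d" "d \<le> 1 / 3" "\<bar>k\<bar> \<le> 1"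
    for a b c d k :: real
    using bound[of a c b d k] that by (simp add: algebra_simps)
  have "norm (pull_u M p u v) \<le> 2 * (pi / 2 - 0)"
    unfolding pull_u_def
    by (rule integral_bound) (auto intro!: continuous_intros D bound deficit_bounds simp del: real_norm_def)
  then show "\<bar>pull_u M p u v\<bar> \<le> pi" by simp
  have "norm (pull_v M p u v) \<le> 2 * (pi / 2 - 0)"
    unfolding pull_v_def
    by (rule integral_bound) (auto intro!: continuous_intros D bound' deficit_bounds simp del: real_norm_def)
  then show "\<bar>pull_v M p u v\<bar> \<le> pi" by simp
qed

end

section \<open>Normals of half-spaces with a given boundary or containing a given flat\<close>

lemma hyperplane_eq_imp_proportional:
  fixes a a' :: "'a::real_inner"
  assumes eq: "{x. a \<bullet> x = b} = {x. a' \<bullet> x = b'}" and nz: "a \<noteq> 0" "a' \<noteq> 0"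
  shows "\<exists>k. k \<noteq> 0 \<and> a' = k *\<^sub>R a \<and> b' = k * b"
proof -
  define k where "k = (a' \<bullet> a) / (a \<bullet> a)"
  define q where "q = (b / (a \<bullet> a)) *\<^sub>R a"
  define w where "w = a' - k *\<^sub>R a"
  have aq: "a \<bullet> q = b" and aw: "a \<bullet> w = 0"
    using nz by (auto simp: q_def w_def k_def inner_diff_right inner_commute)
  have "q \<in> {x. a \<bullet> x = b}" "q + w \<in> {x. a \<bullet> x = b}" using aq aw by (auto simp: inner_add_right)
  then have a'q: "a' \<bullet> q = b'" and "a' \<bullet> (q + w) = b'" unfolding eq by auto
  then have "a' \<bullet> w = 0" by (simp add: inner_add_right)
  then have "w \<bullet> w = 0" using aw by (simp add: w_def inner_diff_left)
  then have a': "a' = k *\<^sub>R a" by (simp add: w_def)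
  then show ?thesis using nz aq a'q by (intro exI[of _ k]) auto
qed

lemma closed_halfspace_bounded_byD:
  assumes "closed_halfspace_bounded_by S {x. a \<bullet> x = b}" and "a \<noteq> 0"
  shows "S = {x. a \<bullet> x \<le> b} \<or> S = {x. - a \<bullet> x \<le> - b}"
proof -
  obtain a' b' where ab: "a' \<noteq> 0" "{x. a \<bullet> x = b} = {x. a' \<bullet> x = b'}" and S: "S = {x. a' \<bullet> x \<le> b'}"
    using assms(1) by (auto simp: closed_halfspace_bounded_by_def)
  obtain k where k: "k \<noteq> 0" "a' = k *\<^sub>R a" "b' = k * b"
    using hyperplane_eq_imp_proportional[OF ab(2) assms(2) ab(1)] by blast
  show ?thesis
    using k(1) by (cases "0 < k") (auto simp: S k(2,3) mult_le_cancel_left)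
qed

text \<open>The component \<open>w\<close> of \<open>a\<close> orthogonal to \<open>u\<close> and
  \<open>v\<close> is a direction of the flat through \<open>p\<close>; if it were nonzero,
  \<open>a\<close> would be unbounded above along it.\<close>

lemma normal_in_plane:
  fixes a u v :: "'a::real_inner"
  assumes uv: "norm u = 1" "norm v = 1" "u \<bullet> v = 0"
    and sub: "\<And>w. u \<bullet> w = 0 \<Longrightarrow> v \<bullet> w = 0 \<Longrightarrow> a \<bullet> (p + w) \<le> b"
  shows "a = (a \<bullet> u) *\<^sub>R u + (a \<bullet> v) *\<^sub>R v"
proof -
  define w where "w = a - ((a \<bullet> u) *\<^sub>R u + (a \<bullet> v) *\<^sub>R v)"
  have n: "u \<bullet> u = 1" "v \<bullet> v = 1" using uv by (simp_all add: norm_eq_1)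
  have w: "u \<bullet> w = 0" "v \<bullet> w = 0"
    using n uv(3) by (simp_all add: w_def inner_diff_right inner_add_right inner_commute)
  have "a \<bullet> w = (w + ((a \<bullet> u) *\<^sub>R u + (a \<bullet> v) *\<^sub>R v)) \<bullet> w" by (simp add: w_def)
  then have aw: "a \<bullet> w = w \<bullet> w" using w by (simp add: inner_add_left)
  have "w \<bullet> w = 0"
  proof (rule ccontr)
    assume nz: "w \<bullet> w \<noteq> 0"
    \<comment> \<open>Chosen so that \<open>a \<bullet> (p + \<tau> *\<^sub>R w)\<close> equals
      \<open>b + 1\<close>.\<close>
    define \<tau> where "\<tau> = (b - a \<bullet> p + 1) / (w \<bullet> w)"
    have "a \<bullet> (p + \<tau> *\<^sub>R w) \<le> b" using w by (intro sub) auto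
    then show False using nz by (simp add: inner_add_right aw \<tau>_def)
  qed
  then show ?thesis by (simp add: w_def)
qed


text \<open>For orthonormal \<open>u\<close> and \<open>v\<close>, the unit vector at cosine
  \<open>z\<close> to \<open>u\<close> on the side of \<open>v\<close>. Negating \<open>u\<close>
  and \<open>z\<close> fixes it; negating \<open>v\<close> and \<open>z\<close> negates it.\<close>

definition second_normal :: "'a::real_vector \<Rightarrow> 'a \<Rightarrow> real \<Rightarrow> 'a" where
  "second_normal u v z = z *\<^sub>R u + sqrt (1 - z\<^sup>2) *\<^sub>R v"

text \<open>For orthonormal \<open>u\<close>, \<open>v\<close> and \<open>z\<^sup>2 < 1\<close>, the
  point of their span that lies on both hyperplanes.\<close>

definition crossing :: "'a::real_vector \<Rightarrow> 'a \<Rightarrow> real \<Rightarrow> real \<Rightarrow> real \<Rightarrow> 'a" where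
  "crossing u v r s z = r *\<^sub>R u + ((s - z * r) / sqrt (1 - z\<^sup>2)) *\<^sub>R v"

lemma crossing_on_hyperplanes:
  fixes u v :: "'a::real_inner"
  assumes "norm u = 1" "norm v = 1" "u \<bullet> v = 0" "z\<^sup>2 < 1"
  shows "u \<bullet> crossing u v r s z = r" "second_normal u v z \<bullet> crossing u v r s z = s"
proof -
  have "u \<bullet> u = 1" "v \<bullet> v = 1" "v \<bullet> u = 0" using assms by (simp_all add: norm_eq_1 inner_commute)
  moreover have "sqrt (1 - z\<^sup>2) \<noteq> 0" using assms(4) by simp
  ultimately show "u \<bullet> crossing u v r s z = r" "second_normal u v z \<bullet> crossing u v r s z = s"
    using assms(3) by (simp_all add: crossing_def second_normal_def inner_add_left inner_add_right)
qed

lemma norm_second_normal: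
  fixes u v :: "'a::real_inner"
  assumes "norm u = 1" "norm v = 1" "u \<bullet> v = 0" "z \<in> {-1..1}"
  shows "norm (second_normal u v z) = 1"
proof -
  have "z\<^sup>2 \<le> 1" using assms(4) by (simp add: abs_square_le_1 abs_le_iff)
  then show ?thesis
    unfolding second_normal_def using assms by (intro orthonormal_combination_nonzero(1)) auto
qed

section \<open>The pair of hyperplanes\<close>

text \<open>The unknowns are the normal \<open>u\<close> of the first hyperplane, a unit vector \<open>v\<close> orthogonal to it
  that spans with \<open>u\<close> the normal plane of the intersection, the offsets \<open>r\<close> and \<open>s\<close>, and the
  cosine \<open>z\<close> of the angle between the two normals.\<close>

theorem ex_quartering_central_pair:
  fixes \<mu> :: "nat \<Rightarrow> 'a::euclidean_space measure"
  assumes dim: "DIM('a) = Suc n" and n: "0 < n" and \<mu>: "\<And>i. i \<in> {1..Suc n} \<Longrightarrow> ac_prob_space (\<mu> i)"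
  shows "\<exists>u v r s z. norm u = 1 \<and> norm v = 1 \<and> u \<bullet> v = 0 \<and> z\<^sup>2 < 1 \<and>
    half (\<mu> 1) u r = 1 / 2 \<and> half (\<mu> 1) (second_normal u v z) s = 1 / 2 \<and>
    quarter (\<mu> 1) u r (second_normal u v z) s = 1 / 4 \<and> half (\<mu> (Suc n)) u r = 1 / 2 \<and>
    (\<forall>i\<in>{2..n}. pull_u (\<mu> i) (crossing u v r s z) u v = 0 \<and> pull_v (\<mu> i) (crossing u v r s z) u v = 0)"
proof -
  note [simp del] = One_nat_def add_2_eq_Suc add_2_eq_Suc'
  interpret ac_prob_space "\<mu> 1" by (rule \<mu>) simp
  \<comment> \<open>In every direction the medians of \<open>\<mu> 1\<close> lie between
    \<open>- R\<close> and \<open>R\<close>, so with offsets scaled by \<open>R\<close> the halving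
    equations have opposite signs at \<open>-1\<close> and \<open>1\<close>.\<close>
  obtain R where R: "0 < R" "\<And>a. norm a = 1 \<Longrightarrow> half (\<mu> 1) a (- R) < 1 / 2 \<and> 1 / 2 < half (\<mu> 1) a R"
    using ex_radius by blast
  define g1 where "g1 u r = half (\<mu> 1) u r - 1 / 2" for u r
  \<comment> \<open>The covariance of the indicators of the two half-spaces. Unlike the quarter
    mass, it changes sign when either half-space is flipped; once both halves are
    \<open>1 / 2\<close>, it vanishes exactly if the quarter is \<open>1 / 4\<close>.\<close>
  define cov where "cov u r a s = quarter (\<mu> 1) u r a s - half (\<mu> 1) u r * half (\<mu> 1) a s" for u r a s
  \<comment> \<open>Both \<open>j + 2\<close> and \<open>j - n + 2\<close> run over \<open>2\<close>
    to \<open>n\<close>; slot \<open>n - 1\<close> is reserved for orthogonality. The term with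
    \<open>z\<close> has the parities of the covariance, makes the last equation strict at
    \<open>z = 1\<close> and \<open>z = -1\<close>, and vanishes once both halvings hold.\<close>
  define F :: "nat \<Rightarrow> 'a \<times> 'a \<times> real \<times> real \<times> real \<Rightarrow> real" where
    "F j = (\<lambda>(u, v, r, s, z).
      if j < n - 1 then sqrt (1 - z\<^sup>2) * pull_v (\<mu> (j + 2)) (crossing u v (R * r) (R * s) z) u v
      else if j = n - 1 then 0
      else if j < 2 * n - 1 then sqrt (1 - z\<^sup>2) * pull_u (\<mu> (j - n + 2)) (crossing u v (R * r) (R * s) z) u v
      else if j = 2 * n - 1 then half (\<mu> (Suc n)) u (R * r) - 1 / 2
      else if j = 2 * n then g1 u (R * r)
      else if j = 2 * n + 1 then g1 (second_normal u v z) (R * s)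
      else cov u (R * r) (second_normal u v z) (R * s)
        + z * (\<bar>g1 u (R * r)\<bar> + \<bar>g1 (second_normal u v z) (R * s)\<bar>))" for j
  have F_simps:
    "j < n - 1 \<Longrightarrow> F j (u, v, r, s, z) = sqrt (1 - z\<^sup>2) * pull_v (\<mu> (j + 2)) (crossing u v (R * r) (R * s) z) u v"
    "F (n - 1) (u, v, r, s, z) = 0"
    "n \<le> j \<Longrightarrow> j < 2 * n - 1 \<Longrightarrow> F j (u, v, r, s, z) = sqrt (1 - z\<^sup>2) * pull_u (\<mu> (j - n + 2)) (crossing u v (R * r) (R * s) z) u v"
    "F (2 * n - 1) (u, v, r, s, z) = half (\<mu> (Suc n)) u (R * r) - 1 / 2"
    "F (2 * n) (u, v, r, s, z) = g1 u (R * r)"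
    "F (2 * n + 1) (u, v, r, s, z) = g1 (second_normal u v z) (R * s)"
    "F (2 * n + 2) (u, v, r, s, z) = cov u (R * r) (second_normal u v z) (R * s)
        + z * (\<bar>g1 u (R * r)\<bar> + \<bar>g1 (second_normal u v z) (R * s)\<bar>)" for j u v r s z
    using n by (auto simp: F_def)
  have cases: "j < n - 1 \<or> j = n - 1 \<or> n \<le> j \<and> j < 2 * n - 1 \<or> j = 2 * n - 1 \<or> j = 2 * n \<or> j = 2 * n + 1 \<or> j = 2 * n + 2"
    if "j < 2 * n + 3" for j using that by arith
  have frame: "norm u = 1" "norm v = 1" "u \<bullet> v = 0" "u \<noteq> 0" "second_normal u v z \<noteq> 0"
      "norm (second_normal u v z) = 1" "z \<in> {-1..1}" if "(u, v, r, s, z) \<in> frames" for u v :: 'a and r s z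
    using that norm_second_normal[of u v z] by (auto simp: frames_def)
  have a_u: "second_normal (- u) v (- z) = second_normal u v z" for u v :: 'a and z by (simp add: second_normal_def)
  have a_v: "second_normal u (- v) (- z) = - second_normal u v z" for u v :: 'a and z by (simp add: second_normal_def)
  have c_u: "crossing (- u) v (- r) s (- z) = crossing u v r s z" for u v :: 'a and r s z
    by (simp add: crossing_def)
  have c_v: "crossing u (- v) r (- s) (- z) = crossing u v r s z" for u v :: 'a and r s z
  proof -
    have "- s - - z * r = - (s - z * r)" by simp
    then show ?thesis
      unfolding crossing_def by (simp only: minus_divide_left [symmetric] power2_minus scaleR_minus_left scaleR_minus_right minus_minus)
  qed
  have g1_minus: "g1 (- a) (- r) = - g1 a r" if "a \<noteq> 0" for a r
    using half_minus[OF that] by (simp add: g1_def)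
  have cov_minus: "cov (- a) (- r) b s = - cov a r b s" if "a \<noteq> 0" for a r b s
    by (simp only: cov_def half_minus[OF that] quarter_minus[OF that]) (simp add: algebra_simps)
  have cov_minus': "cov a r (- b) (- s) = - cov a r b s" if "b \<noteq> 0" for a r b s
    by (simp only: cov_def half_minus[OF that] quarter_minus'[OF that]) (simp add: algebra_simps)
  \<comment> \<open>For nested half-spaces of masses \<open>x\<close> and \<open>y\<close> the
    covariance is \<open>min x y - x * y\<close>: never negative, and \<open>1 / 4\<close> at two
    medians. Away from two medians the absolute values are positive.\<close>
  have cov_same: "0 < cov a r a s + (\<bar>g1 a r\<bar> + \<bar>g1 a s\<bar>)" for a r s
  proof (cases "g1 a r = 0 \<and> g1 a s = 0")
    case True
    then have "half (\<mu> 1) a r = 1 / 2" "half (\<mu> 1) a s = 1 / 2" by (simp_all add: g1_def)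
    then show ?thesis by (simp only: cov_def g1_def quarter_same)
  next
    case False
    have "x * y \<le> min x y" if "0 \<le> x" "x \<le> 1" "0 \<le> y" "y \<le> 1" for x y :: real
      using mult_left_le[of y x] mult_right_le_one_le[of y x] that by (auto simp: mult.commute)
    then have "0 \<le> cov a r a s" by (simp add: cov_def quarter_same half_bounds)
    then show ?thesis using False by linarith
  qed
  let ?a = "\<lambda>p :: 'a \<times> 'a \<times> real \<times> real \<times> real. second_normal (fst p) (fst (snd p)) (snd (snd (snd (snd p))))"
  let ?c = "\<lambda>p :: 'a \<times> 'a \<times> real \<times> real \<times> real. sqrt (1 - (snd (snd (snd (snd p))))\<^sup>2)"
  let ?x = "\<lambda>p :: 'a \<times> 'a \<times> real \<times> real \<times> real. crossing (fst p) (fst (snd p)) (R * fst (snd (snd p))) (R * fst (snd (snd (snd p)))) (snd (snd (snd (snd p))))"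
  have cont_a: "continuous_on frames ?a"
    unfolding second_normal_def by (intro continuous_intros)
  have cont_c: "continuous_on frames ?c"
    by (intro continuous_intros)
  have "continuous_on {p \<in> frames. ?c p \<noteq> 0} ?x"
    unfolding crossing_def by (intro continuous_intros) auto
  note cont_pull = ac_prob_space.continuous_on_pull[OF \<mu> this, of _ fst "\<lambda>p. fst (snd p)"]
  have cont_half: "continuous_on frames (\<lambda>p. half (\<mu> i) (fst p) (R * fst (snd (snd p))))"
    if "i \<in> {1..Suc n}" for i
    by (rule ac_prob_space.continuous_on_half[OF \<mu>[OF that]]) (auto intro!: continuous_intros simp: frames_def)
  have cont_half': "continuous_on frames (\<lambda>p. half (\<mu> 1) (?a p) (R * fst (snd (snd (snd p)))))"
    by (rule continuous_on_half[OF cont_a]) (auto intro!: continuous_intros frame)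
  have cont_quarter: "continuous_on frames (\<lambda>p. quarter (\<mu> 1) (fst p) (R * fst (snd (snd p))) (?a p) (R * fst (snd (snd (snd p)))))"
    by (rule continuous_on_quarter[OF _ _ cont_a]) (auto intro!: continuous_intros frame)
  have "\<exists>p\<in>frames. \<forall>j<2 * n + 3. j \<noteq> n - 1 \<longrightarrow> F j p = 0"
  proof (rule common_zero_on_frames[OF dim n])
    fix j assume j: "j < 2 * n + 3"
    show "continuous_on frames (F j)"
    proof -
      consider "j < n - 1" | "j = n - 1" | "n \<le> j" "j < 2 * n - 1" | "j = 2 * n - 1" | "j = 2 * n" | "j = 2 * n + 1" | "j = 2 * n + 2"
        using cases[OF j] by blast
      then show ?thesis
      proof cases
        case 1
        then have i: "j + 2 \<in> {1..Suc n}" by auto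
        have "F j = (\<lambda>p. ?c p * pull_v (\<mu> (j + 2)) (?x p) (fst p) (fst (snd p)))"
          using 1 by (auto simp: F_simps fun_eq_iff)
        moreover have "continuous_on frames \<dots>"
          using ac_prob_space.pull_bounded(2)[OF \<mu>[OF i]]
          by (intro continuous_on_mult_vanishing[OF cont_c cont_pull(2)[OF i]])
            (auto intro!: continuous_intros simp: frames_def)
        ultimately show ?thesis by (simp only:)
      next
        case 2
        then show ?thesis by (simp add: F_def case_prod_unfold)
      next
        case 3
        then have i: "j - n + 2 \<in> {1..Suc n}" by auto
        have "F j = (\<lambda>p. ?c p * pull_u (\<mu> (j - n + 2)) (?x p) (fst p) (fst (snd p)))"
          using 3 by (auto simp: F_simps fun_eq_iff)
        moreover have "continuous_on frames \<dots>"
          using ac_prob_space.pull_bounded(1)[OF \<mu>[OF i]]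
          by (intro continuous_on_mult_vanishing[OF cont_c cont_pull(1)[OF i]])
            (auto intro!: continuous_intros simp: frames_def)
        ultimately show ?thesis by (simp only:)
      next
        case 4
        then have "F j = (\<lambda>p. half (\<mu> (Suc n)) (fst p) (R * fst (snd (snd p))) - 1 / 2)"
          by (auto simp: F_simps g1_def fun_eq_iff)
        then show ?thesis
          by (simp only:) (intro continuous_intros cont_half; simp)
      next
        case 5
        then have "F j = (\<lambda>p. half (\<mu> 1) (fst p) (R * fst (snd (snd p))) - 1 / 2)"
          by (auto simp: F_simps g1_def fun_eq_iff)
        then show ?thesis
          by (simp only:) (intro continuous_intros cont_half; simp)
      next
        case 6
        then have "F j = (\<lambda>p. half (\<mu> 1) (?a p) (R * fst (snd (snd (snd p)))) - 1 / 2)"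
          by (auto simp: F_simps g1_def fun_eq_iff)
        then show ?thesis
          by (simp only:) (intro continuous_intros cont_half'; simp)
      next
        case 7
        then have "F j = (\<lambda>p. quarter (\<mu> 1) (fst p) (R * fst (snd (snd p))) (?a p) (R * fst (snd (snd (snd p))))
            - half (\<mu> 1) (fst p) (R * fst (snd (snd p))) * half (\<mu> 1) (?a p) (R * fst (snd (snd (snd p))))
            + snd (snd (snd (snd p))) * (\<bar>half (\<mu> 1) (fst p) (R * fst (snd (snd p))) - 1 / 2\<bar> + \<bar>half (\<mu> 1) (?a p) (R * fst (snd (snd (snd p)))) - 1 / 2\<bar>))"
          by (auto simp: F_simps cov_def g1_def fun_eq_iff)
        then show ?thesis
          by (simp only:) (intro continuous_intros cont_half cont_half' cont_quarter; simp)
      qed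
    qed
  next
    fix j u v r s z
    assume j: "j < 2 * n + 3" and p: "(u, v, r, s, z) \<in> (frames :: ('a \<times> 'a \<times> real \<times> real \<times> real) set)"
    interpret \<mu>': ac_prob_space "\<mu> (Suc n)" by (rule \<mu>) simp
    show "F j (- u, v, - r, s, - z) = (if u_odd n j then - F j (u, v, r, s, z) else F j (u, v, r, s, z))"
      using cases[OF j] n cov_minus[of u "R * r"] g1_minus[of u "R * r"] \<mu>'.half_minus[of u "R * r"] frame[OF p]
      by (elim disjE) (auto simp: F_simps u_odd_def a_u c_u pull_minus)
    show "F j (u, - v, r, - s, - z) = (if v_odd n j then - F j (u, v, r, s, z) else F j (u, v, r, s, z))"
      using cases[OF j] n cov_minus'[of "second_normal u v z" u "R * r" "R * s"] g1_minus[of "second_normal u v z" "R * s"] frame[OF p]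
      by (elim disjE) (auto simp: F_simps v_odd_def a_v c_v pull_minus)
  next
    fix u v :: 'a and s z :: real
    show "(u, v, -1, s, z) \<in> frames \<Longrightarrow> F (2 * n) (u, v, -1, s, z) < 0"
      "(u, v, 1, s, z) \<in> frames \<Longrightarrow> 0 < F (2 * n) (u, v, 1, s, z)"
      "(u, v, s, -1, z) \<in> frames \<Longrightarrow> F (2 * n + 1) (u, v, s, -1, z) < 0"
      "(u, v, s, 1, z) \<in> frames \<Longrightarrow> 0 < F (2 * n + 1) (u, v, s, 1, z)"
      using R(2) frame by (auto simp only: F_simps g1_def mult_minus_right mult_1_right diff_less_0_iff_less diff_gt_0_iff_gt)
  next
    fix u v :: 'a and r s :: real
    assume p: "(u, v, r, s, -1) \<in> frames"
    have "second_normal u v (-1) = - u" by (simp add: second_normal_def)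
    moreover have "cov u (R * r) (- u) (R * s) = - cov u (R * r) u (- (R * s))" "g1 (- u) (R * s) = - g1 u (- (R * s))"
      using cov_minus'[of u u "R * r" "- (R * s)"] g1_minus[of u "- (R * s)"] frame[OF p] by auto
    ultimately show "F (2 * n + 2) (u, v, r, s, -1) < 0"
      using cov_same[of u "R * r" "- (R * s)"] by (simp only: F_simps) simp
  next
    fix u v :: 'a and r s :: real
    have "second_normal u v 1 = u" by (simp add: second_normal_def)
    then show "0 < F (2 * n + 2) (u, v, r, s, 1)"
      using cov_same[of u "R * r" "R * s"] by (simp only: F_simps) simp
  qed
  then obtain u v r s z where p: "(u, v, r, s, z) \<in> frames"
    and 0: "\<And>j. j < 2 * n + 3 \<Longrightarrow> j \<noteq> n - 1 \<Longrightarrow> F j (u, v, r, s, z) = 0" by auto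
  let ?a = "second_normal u v z"
  have g: "g1 u (R * r) = 0" "g1 ?a (R * s) = 0" "cov u (R * r) ?a (R * s) = 0" "half (\<mu> (Suc n)) u (R * r) = 1 / 2"
    using 0[of "2 * n"] 0[of "2 * n + 1"] 0[of "2 * n + 2"] 0[of "2 * n - 1"] n unfolding F_simps by auto
  \<comment> \<open>With parallel normals, two medians would have nonzero covariance. So the
    hyperplanes cross, and the factor in front of the pull can be cancelled.\<close>
  have "z \<noteq> 1"
    using cov_same[of u "R * r" "R * s"] g by (auto simp: second_normal_def)
  moreover have "z \<noteq> -1"
  proof
    assume "z = -1"
    then have "?a = - u" by (simp add: second_normal_def)
    then show False
      using cov_same[of u "R * r" "- (R * s)"] cov_minus'[of u u "R * r" "- (R * s)"] g1_minus[of u "- (R * s)"] g frame[OF p]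
      by auto
  qed
  ultimately have z: "z\<^sup>2 < 1" using frame(7)[OF p] by (simp add: abs_square_less_1 abs_less_iff)
  then have nz: "sqrt (1 - z\<^sup>2) \<noteq> 0" by simp
  have "pull_u (\<mu> i) (crossing u v (R * r) (R * s) z) u v = 0 \<and> pull_v (\<mu> i) (crossing u v (R * r) (R * s) z) u v = 0"
    if "i \<in> {2..n}" for i
  proof -
    have j: "i - 2 < n - 1" "n \<le> n + (i - 2)" "n + (i - 2) < 2 * n - 1" "i - 2 + 2 = i" "n + (i - 2) - n + 2 = i" using that by auto
    show ?thesis
      using 0[of "i - 2"] 0[of "n + (i - 2)"] nz j(1,3) unfolding F_simps(1)[OF j(1)] F_simps(3)[OF j(2,3)] j(4,5) by auto
  qed
  moreover have halves: "half (\<mu> 1) u (R * r) = 1 / 2" "half (\<mu> 1) ?a (R * s) = 1 / 2"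
    using g by (simp_all add: g1_def)
  moreover have "quarter (\<mu> 1) u (R * r) ?a (R * s) = 1 / 4"
    using g(3) unfolding cov_def halves by simp
  ultimately show ?thesis
    using frame[OF p] z g(4) by (intro exI[of _ u] exI[of _ v] exI[of _ "R * r"] exI[of _ "R * s"] exI[of _ z]) auto
qed

theorem theorem1p8:
  fixes d :: nat and \<mu> :: "nat \<Rightarrow> (real ^ 'n) measure"
  assumes "CARD('n) = d" and "d \<ge> 2"
    and "\<And>i. i \<in> {1..d} \<Longrightarrow> prob_space (\<mu> i)"
    and "\<And>i. i \<in> {1..d} \<Longrightarrow> sets (\<mu> i) = sets borel"
    and "\<And>i. i \<in> {1..d} \<Longrightarrow> absolutely_continuous lborel (\<mu> i)"
  shows "\<exists>H1 H2. is_hyperplane H1 \<and> is_hyperplane H2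
    \<and> split_into_four_equal_parts H1 H2 (\<mu> 1)
    \<and> (\<forall>S. is_closed_halfspace S \<longrightarrow> H1 \<inter> H2 \<subseteq> S \<longrightarrow>
          (\<forall>i\<in>{2..d - 1}. measure (\<mu> i) S \<ge> 1 / 3))
    \<and> splits_into_two_equal_parts H1 (\<mu> d)"
proof -
  define n where "n = d - 1"
  have d: "d = Suc n" and n: "0 < n" using assms(2) by (auto simp: n_def)
  have ac: "ac_prob_space (\<mu> i)" if "i \<in> {1..Suc n}" for i
    using assms(3-5)[of i] that by (simp add: ac_prob_space_def ac_prob_space_axioms_def d)
  have "DIM(real ^ 'n) = Suc n" using assms(1) d by simp
  from ex_quartering_central_pair[where \<mu> = \<mu>, OF this n ac] obtain u v :: "real ^ 'n" and r s z
    where uv: "norm u = 1" "norm v = 1" "u \<bullet> v = 0" and z: "z\<^sup>2 < 1"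
      and half1: "half (\<mu> 1) u r = 1 / 2" and half2: "half (\<mu> 1) (second_normal u v z) s = 1 / 2"
      and quarter1: "quarter (\<mu> 1) u r (second_normal u v z) s = 1 / 4"
      and halfd: "half (\<mu> (Suc n)) u r = 1 / 2"
      and pull: "\<And>i. i \<in> {2..n} \<Longrightarrow> pull_u (\<mu> i) (crossing u v r s z) u v = 0 \<and> pull_v (\<mu> i) (crossing u v r s z) u v = 0"
    by blast
  define a where "a = second_normal u v z"
  define p where "p = crossing u v r s z"
  have "z \<in> {-1..1}" using z by (simp add: abs_square_less_1 abs_less_iff)
  then have nz: "u \<noteq> 0" "a \<noteq> 0"
    using uv norm_second_normal[OF uv, of z] by (auto simp: a_def)
  let ?H1 = "{x. u \<bullet> x = r}" and ?H2 = "{x. a \<bullet> x = s}"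
  have p: "u \<bullet> p = r" "a \<bullet> p = s"
    using crossing_on_hyperplanes[OF uv z] by (simp_all add: a_def p_def)
  interpret m1: ac_prob_space "\<mu> 1" by (rule ac) simp
  interpret md: ac_prob_space "\<mu> (Suc n)" by (rule ac) simp
  have "split_into_four_equal_parts ?H1 ?H2 (\<mu> 1)"
    unfolding split_into_four_equal_parts_def
  proof (intro allI impI)
    fix S T assume S: "closed_halfspace_bounded_by S ?H1" and T: "closed_halfspace_bounded_by T ?H2"
    have "quarter (\<mu> 1) u r a s = 1 / 4" "quarter (\<mu> 1) (- u) (- r) a s = 1 / 4"
        "quarter (\<mu> 1) u r (- a) (- s) = 1 / 4" "quarter (\<mu> 1) (- u) (- r) (- a) (- s) = 1 / 4"
      using quarter1 half1 half2
      by (simp_all add: a_def[symmetric] m1.quarter_minus[OF nz(1)] m1.quarter_minus'[OF nz(2)]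
          m1.half_minus[OF nz(1)] m1.half_minus[OF nz(2)] del: One_nat_def)
    then show "measure (\<mu> 1) (S \<inter> T) = 1 / 4"
      using closed_halfspace_bounded_byD[OF S nz(1)] closed_halfspace_bounded_byD[OF T nz(2)]
      by (auto simp only: quarter_def Int_def mem_Collect_eq)
  qed
  moreover have "splits_into_two_equal_parts ?H1 (\<mu> d)"
    unfolding splits_into_two_equal_parts_def
  proof (intro allI impI)
    fix S assume S: "closed_halfspace_bounded_by S ?H1"
    show "measure (\<mu> d) S = 1 / 2"
      using closed_halfspace_bounded_byD[OF S nz(1)] halfd md.half_minus[OF nz(1), of r]
      by (auto simp only: half_def d)
  qed
  moreover have "1 / 3 \<le> measure (\<mu> i) S"
    if S: "is_closed_halfspace S" "?H1 \<inter> ?H2 \<subseteq> S" and i: "i \<in> {2..d - 1}" for S i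
  proof -
    obtain c b where c: "c \<noteq> 0" and Sc: "S = {x. c \<bullet> x \<le> b}"
      using S(1) by (auto simp: is_closed_halfspace_def closed_halfspace_bounded_by_def)
    have i': "i \<in> {2..n}" using i d by auto
    interpret mi: ac_prob_space "\<mu> i" using i' by (intro ac) auto
    have sub: "c \<bullet> (p + w) \<le> b" if "u \<bullet> w = 0" "v \<bullet> w = 0" for w
    proof -
      have "p + w \<in> ?H1 \<inter> ?H2"
        using p that by (simp add: inner_add_right) (simp add: a_def second_normal_def inner_add_left)
      then show ?thesis using S(2) Sc by auto
    qed
    \<comment> \<open>Dividing by \<open>N\<close> puts the plane coordinates of the normal
      \<open>c\<close> on the unit circle, where the deficits are known to vanish.\<close>
    define N where "N = norm (Complex (c \<bullet> u) (c \<bullet> v))"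
    have c_eq: "c = (c \<bullet> u) *\<^sub>R u + (c \<bullet> v) *\<^sub>R v" using uv sub by (rule normal_in_plane)
    have "N \<noteq> 0" using c c_eq by (auto simp: N_def complex_eq_iff)
    then have N: "0 < N" by (simp add: N_def)
    have "N\<^sup>2 = (c \<bullet> u)\<^sup>2 + (c \<bullet> v)\<^sup>2" by (simp add: N_def cmod_power2)
    then have "((c \<bullet> u) / N)\<^sup>2 + ((c \<bullet> v) / N)\<^sup>2 = N\<^sup>2 / N\<^sup>2"
      by (simp only: power_divide add_divide_distrib)
    also have "\<dots> = 1" using N by simp
    finally have "deficit (\<mu> i) p u v ((c \<bullet> u) / N) ((c \<bullet> v) / N) = 0"
      using pull[OF i'] by (intro mi.no_deficit_if_no_pull uv) (auto simp: p_def)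
    moreover have "((c \<bullet> u) / N) *\<^sub>R u + ((c \<bullet> v) / N) *\<^sub>R v = c /\<^sub>R N"
      by (subst (3) c_eq) (simp add: scaleR_add_right divide_inverse mult.commute)
    ultimately have "1 / 3 \<le> half (\<mu> i) (c /\<^sub>R N) ((c /\<^sub>R N) \<bullet> p)"
      by (simp add: deficit_def)
    also have "\<dots> = measure (\<mu> i) {x. c \<bullet> x \<le> c \<bullet> p}"
      using N by (simp add: half_def)
    \<comment> \<open>As \<open>p\<close> lies in \<open>S\<close>, the half-space \<open>S\<close>
      contains its parallel translate through \<open>p\<close>.\<close>
    also have "\<dots> \<le> measure (\<mu> i) S"
      using sub[of 0] unfolding Sc
      by (intro mi.finite_measure_mono mi.closed_in_sets closed_halfspace_le) auto
    finally show ?thesis .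
  qed
  moreover have "is_hyperplane ?H1" "is_hyperplane ?H2"
    using nz by (auto simp: is_hyperplane_def)
  ultimately show ?thesis by blast
qed

end
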